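(* Let $X, d$ be an algebraic Yoneda-complete quasi-metric space, with strong basis $\mathcal B$. The space of quasi-lenses on $X, d$, with the $d_{\mathcal P}$ quasi-metric, is algebraic Yoneda-complete. Every quasi-lens of the form $(\uparrow E, \downarrow E)$ where $E$ is a finite non-empty set of center points is a center point in the space of quasi-lenses, and those such that $E \subseteq \mathcal B$ form a strong basis.
   Context: A quasi-metric on $X$ is a map $d \colon X \times X \to [0,+\infty]$ with $d(x,x)=0$, the triangle inequality, and $d(x,y)=d(y,x)=0 \Rightarrow x=y$. Formal balls are pairs $(x,r)$, $x\in X$, $r\in [0,+\infty)$, ordered by $(x,r) \leq^{d^+} (y,s)$ iff $d(x,y) \leq r-s$; they form the poset $\mathbf{B}(X,d)$, with its Scott topology. $X$ is given the $d$-Scott topology, the coarsest one making $x \mapsto (x,0) \in \mathbf{B}(X,d)$ continuous; $\uparrow$, $\downarrow$ are upward and downward closure in the specialization ordering ($x \leq y$ iff $d(x,y)=0$). $X,d$ is Yoneda-complete iff $\mathbf{B}(X,d)$ is a dcpo. A point $x$ is a center point iff for every $\epsilon>0$, $\{(y,s) \in \mathbf{B}(X,d) \mid d(x,y) < \epsilon - s\}$ is Scott-open. A strong basis is a set $\mathcal{B}$ of center points such that for every $x \in X$, $(x,0)$ is the supremum in $\mathbf{B}(X,d)$ of a directed family of formal balls with centers in $\mathcal{B}$. $X,d$ is algebraic iff it has a strong basis. A quasi-lens on $X$ is a pair $(Q,C)$ of a compact saturated (= upwards-closed compact, no separation axiom) set $Q$ and a closed set $C$ such that $Q$ intersects $C$,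 $Q \subseteq \uparrow(Q\cap C)$, and for every open neighborhood $U$ of $Q$, $C \subseteq cl(U\cap C)$. $d_{\mathcal P}((Q,C),(Q',C')) = \max(d_{\mathcal Q}(Q,Q'), d_{\mathcal H}(C,C'))$, where $d_{\mathcal Q}(Q,Q') = \sup_h \mathsf{d}_{\mathbb R}(\inf_{x\in Q} h(x), \inf_{x\in Q'} h(x))$ and $d_{\mathcal H}(C,C') = \sup_h \mathsf{d}_{\mathbb R}(\sup_{x\in C} h(x), \sup_{x\in C'} h(x))$; here $h$ ranges over the $1$-Lipschitz continuous maps from $X,d$ to $[0,+\infty],\mathsf{d}_{\mathbb R}$ (those such that $(x,r)\mapsto(h(x),r)$ is Scott-continuous from $\mathbf{B}(X,d)$ to $\mathbf{B}([0,+\infty],\mathsf{d}_{\mathbb R})$), and $\mathsf{d}_{\mathbb R}(x,y)=0$ if $x \leq y$, $+\infty$ if $x=+\infty\neq y$, $x-y$ if $+\infty>x>y$. (On Yoneda-complete spaces, $d_{\mathcal Q}(Q,Q')=\sup_{x'\in Q'}\inf_{x\in Q} d(x,x')$, and $d_{\mathcal H}(C,C')=\sup_{x\in C}\sup\{r \mid (x,r)\notin cl_{\mathbf B}(C')\}$ with $cl_{\mathbf B}(C')$ the closure of $\{(y,0)\mid y\in C'\}$ in $\mathbf{B}(X,d)$.) *)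

theory Defs
  imports "HOL-Analysis.Analysis"
begin

section \<open>Posets on a carrier and their Scott topology\<close>

definition directed_on :: "('b \<Rightarrow> 'b \<Rightarrow> bool) \<Rightarrow> 'b set \<Rightarrow> bool" where
  "directed_on le D \<longleftrightarrow> D \<noteq> {} \<and> (\<forall>a\<in>D. \<forall>b\<in>D. \<exists>c\<in>D. le a c \<and> le b c)"

definition is_sup_on :: "'b set \<Rightarrow> ('b \<Rightarrow> 'b \<Rightarrow> bool) \<Rightarrow> 'b set \<Rightarrow> 'b \<Rightarrow> bool" where
  "is_sup_on P le D s \<longleftrightarrow>
     s \<in> P \<and> (\<forall>a\<in>D. le a s) \<and> (\<forall>u\<in>P. (\<forall>a\<in>D. le a u) \<longrightarrow> le s u)"

definition dcpo_on :: "'b set \<Rightarrow> ('b \<Rightarrow> 'b \<Rightarrow> bool) \<Rightarrow> bool" where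
  "dcpo_on P le \<longleftrightarrow>
     reflp_on P le \<and> transp_on P le \<and> antisymp_on P le \<and>
     (\<forall>D. D \<subseteq> P \<and> directed_on le D \<longrightarrow> (\<exists>s. is_sup_on P le D s))"

definition scott_open_on :: "'b set \<Rightarrow> ('b \<Rightarrow> 'b \<Rightarrow> bool) \<Rightarrow> 'b set \<Rightarrow> bool" where
  "scott_open_on P le U \<longleftrightarrow>
     U \<subseteq> P \<and>
     (\<forall>a\<in>U. \<forall>b\<in>P. le a b \<longrightarrow> b \<in> U) \<and>
     (\<forall>D s. D \<subseteq> P \<and> directed_on le D \<and> is_sup_on P le D s \<and> s \<in> U \<longrightarrow> D \<inter> U \<noteq> {})"

definition scott_topology :: "'b set \<Rightarrow> ('b \<Rightarrow> 'b \<Rightarrow> bool) \<Rightarrow> 'b topology" where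
  "scott_topology P le = topology (scott_open_on P le)"

lemma scott_open_onI:
  assumes "U \<subseteq> P"
    and "\<And>a b. a \<in> U \<Longrightarrow> b \<in> P \<Longrightarrow> le a b \<Longrightarrow> b \<in> U"
    and "\<And>D s. D \<subseteq> P \<Longrightarrow> directed_on le D \<Longrightarrow> is_sup_on P le D s \<Longrightarrow> s \<in> U
           \<Longrightarrow> \<exists>a\<in>D. a \<in> U"
  shows "scott_open_on P le U"
  unfolding scott_open_on_def using assms by (simp add: disjoint_iff) metis

lemma scott_open_onD:
  assumes "scott_open_on P le U"
  shows "U \<subseteq> P"
    and "\<And>a b. a \<in> U \<Longrightarrow> b \<in> P \<Longrightarrow> le a b \<Longrightarrow> b \<in> U"
    and "\<And>D s. D \<subseteq> P \<Longrightarrow> directed_on le D \<Longrightarrow> is_sup_on P le D s \<Longrightarrow> s \<in> U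
           \<Longrightarrow> \<exists>a\<in>D. a \<in> U"
proof -
  show "U \<subseteq> P"
    using assms by (simp add: scott_open_on_def)
  show "b \<in> U" if "a \<in> U" "b \<in> P" "le a b" for a b
    using assms that unfolding scott_open_on_def by metis
  show "\<exists>a\<in>D. a \<in> U"
    if "D \<subseteq> P" "directed_on le D" "is_sup_on P le D s" "s \<in> U" for D s
  proof -
    have "D \<inter> U \<noteq> {}"
      using assms that unfolding scott_open_on_def by metis
    then show ?thesis by auto
  qed
qed

lemma istopology_scott_open_on: "istopology (scott_open_on P le)"
  unfolding istopology_def
proof (intro conjI allI impI)
  fix S T assume S: "scott_open_on P le S" and T: "scott_open_on P le T"
  show "scott_open_on P le (S \<inter> T)"
  proof (rule scott_open_onI)
    show "S \<inter> T \<subseteq> P" using scott_open_onD(1)[OF S] by auto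
  next
    fix a b assume "a \<in> S \<inter> T" "b \<in> P" "le a b"
    then show "b \<in> S \<inter> T"
      using scott_open_onD(2)[OF S, of a b] scott_open_onD(2)[OF T, of a b] by simp
  next
    fix D s
    assume D: "D \<subseteq> P" "directed_on le D" "is_sup_on P le D s" and s: "s \<in> S \<inter> T"
    obtain a where a: "a \<in> D" "a \<in> S" using scott_open_onD(3)[OF S D] s by auto
    obtain b where b: "b \<in> D" "b \<in> T" using scott_open_onD(3)[OF T D] s by auto
    obtain c where c: "c \<in> D" "le a c" "le b c"
      using D(2) a(1) b(1) unfolding directed_on_def by metis
    have "c \<in> P" using c(1) D(1) by auto
    then have "c \<in> S" "c \<in> T"
      using scott_open_onD(2)[OF S a(2)] scott_open_onD(2)[OF T b(2)] c by simp_all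
    then show "\<exists>a\<in>D. a \<in> S \<inter> T" using c(1) by auto
  qed
next
  fix \<K> assume K: "\<forall>K\<in>\<K>. scott_open_on P le K"
  show "scott_open_on P le (\<Union>\<K>)"
  proof (rule scott_open_onI)
    show "\<Union>\<K> \<subseteq> P" by (rule Sup_least, rule scott_open_onD(1), rule K[rule_format])
  next
    fix a b assume "a \<in> \<Union>\<K>" and b: "b \<in> P" "le a b"
    then obtain U where U: "U \<in> \<K>" "a \<in> U" by auto
    have "b \<in> U" using scott_open_onD(2)[OF K[rule_format, OF U(1)] U(2) b] .
    then show "b \<in> \<Union>\<K>" using U(1) by auto
  next
    fix D s
    assume D: "D \<subseteq> P" "directed_on le D" "is_sup_on P le D s" and "s \<in> \<Union>\<K>"
    then obtain U where U: "U \<in> \<K>" "s \<in> U" by auto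
    have "\<exists>a\<in>D. a \<in> U" using scott_open_onD(3)[OF K[rule_format, OF U(1)] D U(2)] .
    then show "\<exists>a\<in>D. a \<in> \<Union>\<K>" using U(1) by auto
  qed
qed

lemma openin_scott_topology: "openin (scott_topology P le) U \<longleftrightarrow> scott_open_on P le U"
  by (simp add: scott_topology_def istopology_scott_open_on)


section \<open>Quasi-metric spaces and formal balls\<close>

text \<open>A space is a carrier set together with a distance whose values outside the carrier
  are irrelevant.\<close>

definition quasi_metric :: "'a set \<Rightarrow> ('a \<Rightarrow> 'a \<Rightarrow> ennreal) \<Rightarrow> bool" where
  "quasi_metric X d \<longleftrightarrow>
     (\<forall>x\<in>X. d x x = 0) \<and>
     (\<forall>x\<in>X. \<forall>y\<in>X. \<forall>z\<in>X. d x z \<le> d x y + d y z) \<and>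
     (\<forall>x\<in>X. \<forall>y\<in>X. d x y = 0 \<and> d y x = 0 \<longrightarrow> x = y)"

definition formal_balls :: "'a set \<Rightarrow> ('a \<times> real) set" where
  "formal_balls X = X \<times> {0..}"

text \<open>The conjunct \<open>s \<le> r\<close> is needed because \<^const>\<open>ennreal\<close> maps negative reals to \<open>0\<close>.\<close>

definition ball_le :: "('a \<Rightarrow> 'a \<Rightarrow> ennreal) \<Rightarrow> 'a \<times> real \<Rightarrow> 'a \<times> real \<Rightarrow> bool" where
  "ball_le d = (\<lambda>(x, r) (y, s). s \<le> r \<and> d x y \<le> ennreal (r - s))"

abbreviation ball_topology :: "'a set \<Rightarrow> ('a \<Rightarrow> 'a \<Rightarrow> ennreal) \<Rightarrow> ('a \<times> real) topology" where
  "ball_topology X d \<equiv> scott_topology (formal_balls X) (ball_le d)"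

definition d_scott_topology :: "'a set \<Rightarrow> ('a \<Rightarrow> 'a \<Rightarrow> ennreal) \<Rightarrow> 'a topology" where
  "d_scott_topology X d = pullback_topology X (\<lambda>x. (x, 0)) (ball_topology X d)"

definition up_closure :: "'a set \<Rightarrow> ('a \<Rightarrow> 'a \<Rightarrow> ennreal) \<Rightarrow> 'a set \<Rightarrow> 'a set" where
  "up_closure X d A = {y \<in> X. \<exists>x\<in>A. d x y = 0}"

definition down_closure :: "'a set \<Rightarrow> ('a \<Rightarrow> 'a \<Rightarrow> ennreal) \<Rightarrow> 'a set \<Rightarrow> 'a set" where
  "down_closure X d A = {x \<in> X. \<exists>y\<in>A. d x y = 0}"

definition yoneda_complete :: "'a set \<Rightarrow> ('a \<Rightarrow> 'a \<Rightarrow> ennreal) \<Rightarrow> bool" where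
  "yoneda_complete X d \<longleftrightarrow> dcpo_on (formal_balls X) (ball_le d)"

text \<open>If \<open>\<epsilon> \<le> s\<close>, then \<open>ennreal (\<epsilon> - s) = 0\<close> and the strict inequality below fails,
  as it does in the reals.\<close>

definition center_point :: "'a set \<Rightarrow> ('a \<Rightarrow> 'a \<Rightarrow> ennreal) \<Rightarrow> 'a \<Rightarrow> bool" where
  "center_point X d x \<longleftrightarrow>
     x \<in> X \<and>
     (\<forall>\<epsilon>>0. openin (ball_topology X d)
        {(y, s). (y, s) \<in> formal_balls X \<and> d x y < ennreal (\<epsilon> - s)})"

definition strong_basis :: "'a set \<Rightarrow> ('a \<Rightarrow> 'a \<Rightarrow> ennreal) \<Rightarrow> 'a set \<Rightarrow> bool" where
  "strong_basis X d B \<longleftrightarrow>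
     (\<forall>b\<in>B. center_point X d b) \<and>
     (\<forall>x\<in>X. \<exists>D. D \<subseteq> formal_balls B \<and> directed_on (ball_le d) D \<and>
        is_sup_on (formal_balls X) (ball_le d) D (x, 0))"

definition algebraic_qm :: "'a set \<Rightarrow> ('a \<Rightarrow> 'a \<Rightarrow> ennreal) \<Rightarrow> bool" where
  "algebraic_qm X d \<longleftrightarrow> (\<exists>B. strong_basis X d B)"


section \<open>Quasi-lenses\<close>

definition d_real :: "ennreal \<Rightarrow> ennreal \<Rightarrow> ennreal" where
  "d_real x y = (if x \<le> y then 0 else if x = \<infinity> then \<infinity> else x - y)"

definition lipschitz1_continuous ::
    "'a set \<Rightarrow> ('a \<Rightarrow> 'a \<Rightarrow> ennreal) \<Rightarrow> ('a \<Rightarrow> ennreal) set" where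
  "lipschitz1_continuous X d =
     {h. continuous_map (ball_topology X d) (ball_topology UNIV d_real) (\<lambda>(x, r). (h x, r))}"

definition quasi_lenses :: "'a set \<Rightarrow> ('a \<Rightarrow> 'a \<Rightarrow> ennreal) \<Rightarrow> ('a set \<times> 'a set) set" where
  "quasi_lenses X d =
     {(Q, C).
        compactin (d_scott_topology X d) Q \<and> up_closure X d Q = Q \<and>
        closedin (d_scott_topology X d) C \<and>
        Q \<inter> C \<noteq> {} \<and>
        Q \<subseteq> up_closure X d (Q \<inter> C) \<and>
        (\<forall>U. openin (d_scott_topology X d) U \<and> Q \<subseteq> U \<longrightarrow>
           C \<subseteq> d_scott_topology X d closure_of (U \<inter> C))}"

definition d_Q :: "'a set \<Rightarrow> ('a \<Rightarrow> 'a \<Rightarrow> ennreal) \<Rightarrow> 'a set \<Rightarrow> 'a set \<Rightarrow> ennreal" where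
  "d_Q X d Q Q' =
     (SUP h\<in>lipschitz1_continuous X d. d_real (INF x\<in>Q. h x) (INF x\<in>Q'. h x))"

definition d_H :: "'a set \<Rightarrow> ('a \<Rightarrow> 'a \<Rightarrow> ennreal) \<Rightarrow> 'a set \<Rightarrow> 'a set \<Rightarrow> ennreal" where
  "d_H X d C C' =
     (SUP h\<in>lipschitz1_continuous X d. d_real (SUP x\<in>C. h x) (SUP x\<in>C'. h x))"

definition d_P ::
    "'a set \<Rightarrow> ('a \<Rightarrow> 'a \<Rightarrow> ennreal) \<Rightarrow> 'a set \<times> 'a set \<Rightarrow> 'a set \<times> 'a set \<Rightarrow> ennreal" where
  "d_P X d = (\<lambda>(Q, C) (Q', C'). max (d_Q X d Q Q') (d_H X d C C'))"

definition finitary_lens ::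
    "'a set \<Rightarrow> ('a \<Rightarrow> 'a \<Rightarrow> ennreal) \<Rightarrow> 'a set \<Rightarrow> 'a set \<times> 'a set" where
  "finitary_lens X d E = (up_closure X d E, down_closure X d E)"

end

theory Submission
  imports Defs
begin

text \<open>
  Formal balls on the space of quasi-lenses are tested against Scott-open sets of formal balls of \<open>X\<close>:
  \<open>((Q, C), r)\<close> may be contained in \<open>U\<close> (\<open>Q \<times> {r} \<subseteq> U\<close>, predicate \<open>fb_box\<close>) or may meet it
  (\<open>C \<times> {r}\<close> meets \<open>U\<close>, predicate \<open>fb_dia\<close>).  The ordering given by \<^term>\<open>d_P\<close> is exactly
  preservation of both predicates, because the distance to the complement of an open set \<open>U\<close> is a
  1-Lipschitz continuous map.  Hence the supremum of a directed family, with infimum \<open>r\<close> of radii,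
  is a lens \<open>(Q, C)\<close> at radius \<open>r\<close> satisfying precisely those tests that some member satisfies.
  For \<open>Q\<close> this is the Hofmann-Mislove theorem in the sober space of formal balls; for \<open>C\<close> one builds
  a chain of formal balls centred in the basis whose radii decrease to \<open>r\<close>.  Being at distance
  less than \<open>\<epsilon>\<close> from a finitary lens is the conjunction of finitely many open tests, so finitary
  lenses of center points are center points, and compactness of \<open>Q\<close> and density of \<open>U \<inter> C\<close> in \<open>C\<close>
  yield enough of them to form a strong basis.
\<close>

section \<open>Formal balls\<close>

text \<open>The tests live among formal balls, whereas the conditions on a lens speak of the
  topology of \<open>X\<close>. The two match because, at every radius \<open>r\<close>, the traces
  \<open>{x \<in> X. (x, r) \<in> W}\<close> of Scott-open \<open>W\<close> are exactly the open
  sets of \<open>X\<close>. This rests on translating directed suprema by a constant radius, and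
  completeness of \<open>X\<close> enters there: the translated family has a supremum, which must
  then be the translated one. An open set containing \<open>(x, s)\<close> also contains some
  \<open>(x, s + \<eta>)\<close> with \<open>\<eta> > 0\<close>; this slack turns distance bounds
  into membership and pays for replacing points by nearby centers. The two components of a lens are
  tied by \<open>Q \<subseteq> up_closure X d (Q \<inter> C)\<close> and by density. For a limit,
  both are recovered by using the same condition inside a single member of the family.\<close>

lemma ball_le_iff [simp]: "ball_le d (x, r) (y, s) \<longleftrightarrow> s \<le> r \<and> d x y \<le> ennreal (r - s)"
  by (simp add: ball_le_def)

lemma mem_formal_balls [simp]: "(x, r) \<in> formal_balls X \<longleftrightarrow> x \<in> X \<and> 0 \<le> r"
  by (auto simp: formal_balls_def)

lemma quasi_metricD:
  assumes "quasi_metric X d"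
  shows "x \<in> X \<Longrightarrow> d x x = 0"
    and "x \<in> X \<Longrightarrow> y \<in> X \<Longrightarrow> z \<in> X \<Longrightarrow> d x z \<le> d x y + d y z"
    and "x \<in> X \<Longrightarrow> y \<in> X \<Longrightarrow> d x y = 0 \<Longrightarrow> d y x = 0 \<Longrightarrow> x = y"
  using assms unfolding quasi_metric_def by blast+

lemma ball_le_refl: "quasi_metric X d \<Longrightarrow> p \<in> formal_balls X \<Longrightarrow> ball_le d p p"
  by (cases p) (simp add: quasi_metricD)

lemma ball_le_trans:
  assumes X: "quasi_metric X d"
    and P: "p \<in> formal_balls X" "q \<in> formal_balls X" "u \<in> formal_balls X"
    and le: "ball_le d p q" "ball_le d q u"
  shows "ball_le d p u"
proof -
  obtain x r y s z t where eq: "p = (x, r)" "q = (y, s)" "u = (z, t)"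
    by (metis surj_pair)
  have "d x z \<le> d x y + d y z"
    using quasi_metricD(2)[OF X] P eq by simp
  also have "\<dots> \<le> ennreal (r - s) + ennreal (s - t)"
    using le eq by (intro add_mono) auto
  also have "\<dots> = ennreal (r - t)"
    using le eq by (simp flip: ennreal_plus)
  finally show ?thesis
    using le eq by simp
qed

lemma ball_le_antisym:
  assumes X: "quasi_metric X d"
    and P: "p \<in> formal_balls X" "q \<in> formal_balls X"
    and le: "ball_le d p q" "ball_le d q p"
  shows "p = q"
  using assms quasi_metricD(3)[OF X] by (cases p, cases q) auto

lemma is_sup_on_upper: "is_sup_on P le D p \<Longrightarrow> a \<in> D \<Longrightarrow> le a p"
  by (simp add: is_sup_on_def)

lemma is_sup_on_least:
  "is_sup_on P le D p \<Longrightarrow> u \<in> P \<Longrightarrow> (\<And>a. a \<in> D \<Longrightarrow> le a u) \<Longrightarrow> le p u"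
  by (simp add: is_sup_on_def)

lemma is_sup_on_mem: "is_sup_on P le D p \<Longrightarrow> p \<in> P"
  by (simp add: is_sup_on_def)

lemma is_sup_on_unique:
  assumes "quasi_metric X d" "is_sup_on (formal_balls X) (ball_le d) D p"
    "is_sup_on (formal_balls X) (ball_le d) D q"
  shows "p = q"
  using assms by (intro ball_le_antisym[of X d]) (auto simp: is_sup_on_def)

section \<open>Translation of radii\<close>

definition ball_shift :: "real \<Rightarrow> ('a \<times> real) set \<Rightarrow> ('a \<times> real) set" where
  "ball_shift c D = (\<lambda>(x, r). (x, r + c)) ` D"

lemma mem_ball_shift [simp]: "(x, r) \<in> ball_shift c D \<longleftrightarrow> (x, r - c) \<in> D"
  unfolding ball_shift_def by force

lemma directed_ball_shift:
  assumes "directed_on (ball_le d) D"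
  shows "directed_on (ball_le d) (ball_shift c D)"
  unfolding directed_on_def
proof (intro conjI ballI)
  show "ball_shift c D \<noteq> {}"
    using assms by (auto simp: directed_on_def ball_shift_def)
next
  fix p q assume "p \<in> ball_shift c D" "q \<in> ball_shift c D"
  then obtain x r y s where eq: "p = (x, r)" "q = (y, s)" and "(x, r - c) \<in> D" "(y, s - c) \<in> D"
    by (metis mem_ball_shift surj_pair)
  then obtain z t where "(z, t) \<in> D" "ball_le d (x, r - c) (z, t)" "ball_le d (y, s - c) (z, t)"
    using assms unfolding directed_on_def by (metis surj_pair)
  then have "(z, t + c) \<in> ball_shift c D" "ball_le d p (z, t + c)" "ball_le d q (z, t + c)"
    by (auto simp: eq algebra_simps)
  then show "\<exists>u\<in>ball_shift c D. ball_le d p u \<and> ball_le d q u"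
    by blast
qed

lemma directed_on_finite_ub:
  assumes dir: "directed_on le D" and "D \<subseteq> P" and "finite F" "F \<subseteq> D"
    and tr: "\<And>p q u. p \<in> P \<Longrightarrow> q \<in> P \<Longrightarrow> u \<in> P \<Longrightarrow> le p q \<Longrightarrow> le q u \<Longrightarrow> le p u"
  shows "\<exists>p\<in>D. \<forall>q\<in>F. le q p"
  using \<open>finite F\<close> \<open>F \<subseteq> D\<close>
proof (induction F rule: finite_induct)
  case empty
  then show ?case using dir by (auto simp: directed_on_def)
next
  case (insert q F)
  then obtain p where p: "p \<in> D" "\<forall>q\<in>F. le q p" by auto
  then obtain u where "u \<in> D" "le p u" "le q u"
    using dir insert.prems unfolding directed_on_def by (metis insert_subset)
  then show ?case
    using p insert.prems tr[of _ p u] \<open>D \<subseteq> P\<close> by (intro bexI[of _ u]) auto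
qed

section \<open>The quasi-metric on the extended reals\<close>

text \<open>One additive inequality absorbs the three cases of \<open>d_real\<close>; with a finite
  bound on the right no truncated subtraction is left.\<close>

lemma d_real_le_iff: "d_real x y \<le> ennreal c \<longleftrightarrow> x \<le> y + ennreal c"
proof (cases "x \<le> y")
  case True
  then show ?thesis by (simp add: d_real_def add_increasing2)
next
  case False
  then show ?thesis
    by (auto simp: d_real_def diff_le_self_ennreal ennreal_minus_le_iff top_unique add.commute)
qed

lemma d_real_triangle: "d_real x z \<le> d_real x y + d_real y z"
proof (cases "d_real x y = \<infinity> \<or> d_real y z = \<infinity>")
  case False
  then obtain a b where ab: "d_real x y = ennreal a" "d_real y z = ennreal b" "0 \<le> a" "0 \<le> b"
    by (metis ennreal_cases infinity_ennreal_def)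
  have "x \<le> y + ennreal a" "y \<le> z + ennreal b"
    using ab d_real_le_iff[of x y a] d_real_le_iff[of y z b] by simp_all
  then have "x \<le> (z + ennreal b) + ennreal a"
    by (meson add_right_mono order_trans)
  then have "x \<le> z + ennreal (a + b)"
    using ab by (simp add: ac_simps)
  then have "d_real x z \<le> ennreal (a + b)"
    by (simp only: d_real_le_iff)
  then show ?thesis
    using ab by simp
qed auto

lemma topspace_ball_topology: "topspace (scott_topology P le) = P" if "\<And>D. directed_on le D \<Longrightarrow> D \<noteq> {}"
  for P :: "'b set"
proof
  have "openin (scott_topology P le) P"
    unfolding openin_scott_topology using that by (intro scott_open_onI) auto
  then show "P \<subseteq> topspace (scott_topology P le)" by (rule openin_subset)
  show "topspace (scott_topology P le) \<subseteq> P"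
    using openin_topspace[of "scott_topology P le"] unfolding openin_scott_topology
    by (rule scott_open_onD(1))
qed

text \<open>The complement consists of the formal balls below a single one,
  \<open>(a - c, 0)\<close> if \<open>c \<le> a\<close> and \<open>(0, c - a)\<close> otherwise, so
  it is closed under suprema. The offset \<open>c\<close> encodes a possibly negative level
  \<open>a - c\<close> without subtraction in \<open>ennreal\<close>.\<close>

lemma d_real_superlevel_open:
  assumes a: "0 \<le> a" and c: "0 \<le> c"
  shows "scott_open_on (formal_balls UNIV) (ball_le d_real)
    {(t, s). 0 \<le> s \<and> ennreal (a + s) < t + ennreal c}"
proof (rule scott_open_onI, goal_cases)
  case (2 p q)
  then obtain t s u v where pq: "p = (t, s)" "q = (u, v)" by (metis surj_pair)
  have le: "t \<le> u + ennreal (s - v)" "v \<le> s" "0 \<le> v" and lt: "ennreal (a + s) < t + ennreal c"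
    using 2 pq by (simp_all add: d_real_le_iff)
  have "ennreal (a + v) < u + ennreal c"
  proof (rule ccontr)
    assume "\<not> ?thesis"
    then have le': "u + ennreal c \<le> ennreal (a + v)" by (simp only: not_less)
    have "t + ennreal c \<le> (u + ennreal (s - v)) + ennreal c"
      using le(1) by (rule add_right_mono)
    also have "\<dots> = (u + ennreal c) + ennreal (s - v)" by (simp only: ac_simps)
    also have "\<dots> \<le> ennreal (a + v) + ennreal (s - v)"
      using le' by (rule add_right_mono)
    also have "\<dots> = ennreal (a + s)" using a le by (simp flip: ennreal_plus)
    finally show False using lt by simp
  qed
  then show ?case using pq le by simp
next
  case (3 D p)
  obtain t s where p: "p = (t, s)" by fastforce
  have lt: "ennreal (a + s) < t + ennreal c" "0 \<le> s" using 3 p by auto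
  show ?case
  proof (rule ccontr)
    assume "\<not> ?case"
    then have H: "t' + ennreal c \<le> ennreal (a + s')" "0 \<le> s'" if "(t', s') \<in> D" for t' s'
      using that 3(1) by fastforce+
    show False
    proof (cases "c \<le> a")
      case True
      have "ball_le d_real q (ennreal (a - c), 0)" if "q \<in> D" for q
      proof -
        obtain t' s' where q: "q = (t', s')" by fastforce
        have "t' + ennreal c \<le> (ennreal (a - c) + ennreal s') + ennreal c"
          using H[of t' s'] that q True c by (simp flip: ennreal_plus)
        then show ?thesis
          using H(2) that q by (auto simp: d_real_le_iff)
      qed
      then have "ball_le d_real p (ennreal (a - c), 0)"
        by (intro is_sup_on_least[OF 3(3)]) auto
      then have "t + ennreal c \<le> ennreal (a - c) + ennreal s + ennreal c"
        using p by (simp add: d_real_le_iff)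
      also have "\<dots> = ennreal (a + s)"
        using True c lt by (simp flip: ennreal_plus)
      finally show False using lt by simp
    next
      case False
      have "ball_le d_real q (0, c - a)" if "q \<in> D" for q
      proof -
        obtain t' s' where q: "q = (t', s')" by fastforce
        have "ennreal c \<le> t' + ennreal c" by (simp add: add_increasing)
        also have "\<dots> \<le> ennreal (a + s')" using H(1) that q by simp
        finally have cs: "c \<le> a + s'"
          using a H(2)[of t' s'] that q by (simp del: ennreal_plus)
        have "t' + ennreal c \<le> ennreal (s' - (c - a)) + ennreal c"
          using H[of t' s'] that q cs c by (simp add: algebra_simps flip: ennreal_plus)
        then show ?thesis
          using cs q by (auto simp: d_real_le_iff)
      qed
      then have "ball_le d_real p (0, c - a)"
        using False by (intro is_sup_on_least[OF 3(3)]) auto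
      then have "t + ennreal c \<le> ennreal (s - (c - a)) + ennreal c" "c - a \<le> s"
        using p by (simp_all add: d_real_le_iff)
      then have "t + ennreal c \<le> ennreal (a + s)"
        using c by (simp add: algebra_simps flip: ennreal_plus)
      then show False using lt by simp
    qed
  qed
qed auto

lemma topspace_balls [simp]: "topspace (ball_topology Y e) = formal_balls Y"
  by (rule topspace_ball_topology) (auto simp: directed_on_def)

section \<open>Formal balls of a Yoneda-complete space\<close>

locale yoneda_space =
  fixes X :: "'a set" and d :: "'a \<Rightarrow> 'a \<Rightarrow> ennreal"
  assumes quasi_metric: "quasi_metric X d"
    and yoneda_complete: "yoneda_complete X d"
begin

abbreviation "ball_open \<equiv> scott_open_on (formal_balls X) (ball_le d)"
abbreviation "ball_sup \<equiv> is_sup_on (formal_balls X) (ball_le d)"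
abbreviation "T \<equiv> d_scott_topology X d"

lemma ball_openD: "ball_open U \<Longrightarrow> p \<in> U \<Longrightarrow> q \<in> formal_balls X \<Longrightarrow> ball_le d p q \<Longrightarrow> q \<in> U"
  by (rule scott_open_onD(2))

lemma ball_open_Int: "ball_open U \<Longrightarrow> ball_open V \<Longrightarrow> ball_open (U \<inter> V)"
  using istopology_scott_open_on[of "formal_balls X" "ball_le d"] by (simp add: istopology_def)

lemma ball_open_Union: "(\<And>U. U \<in> \<K> \<Longrightarrow> ball_open U) \<Longrightarrow> ball_open (\<Union>\<K>)"
  using istopology_scott_open_on[of "formal_balls X" "ball_le d"] by (simp add: istopology_def)

lemma ball_open_Un: "ball_open U \<Longrightarrow> ball_open V \<Longrightarrow> ball_open (U \<union> V)"
  using ball_open_Union[of "{U, V}"] by auto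

lemma ball_open_empty: "ball_open {}"
  using ball_open_Union[of "{}"] by simp

lemma ball_open_all: "ball_open (formal_balls X)"
  by (rule scott_open_onI) (auto simp: directed_on_def)

lemma ball_sup_exists:
  assumes "D \<subseteq> formal_balls X" "directed_on (ball_le d) D"
  obtains p where "ball_sup D p"
  using yoneda_complete assms unfolding yoneda_complete_def dcpo_on_def by blast

text \<open>If all radii were at least \<open>s + \<delta>\<close>, the family could be lowered by
  that amount; the supremum of the lowered family, raised again, would be an upper bound of radius
  larger than \<open>s\<close>, which cannot lie above \<open>(x, s)\<close>. So the radius of a
  directed supremum is the infimum of the radii.\<close>

lemma ball_sup_radius:
  assumes D: "D \<subseteq> formal_balls X" "directed_on (ball_le d) D" and sup: "ball_sup D (x, s)"
    and "0 < \<delta>"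
  shows "\<exists>(y, t)\<in>D. t < s + \<delta>"
proof (rule ccontr)
  assume "\<not> ?thesis"
  then have ge: "s + \<delta> \<le> t" if "(y, t) \<in> D" for y t
    using that by force
  have "0 \<le> s" using sup by (simp add: is_sup_on_def)
  let ?D = "ball_shift (- (s + \<delta>)) D"
  have "?D \<subseteq> formal_balls X"
    using D(1) ge by (force simp: ball_shift_def)
  then obtain z s' where z: "ball_sup ?D (z, s')"
    by (metis ball_sup_exists D(2) directed_ball_shift surj_pair)
  then have "0 \<le> s'" "z \<in> X" by (simp_all add: is_sup_on_def)
  have "ball_le d p (z, s' + s + \<delta>)" if "p \<in> D" for p
  proof -
    obtain y t where p: "p = (y, t)" by fastforce
    then have "(y, t - (s + \<delta>)) \<in> ?D" using that by simp
    then have "ball_le d (y, t - (s + \<delta>)) (z, s')"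
      using z unfolding is_sup_on_def by blast
    then show ?thesis by (simp add: p algebra_simps)
  qed
  then have "ball_le d (x, s) (z, s' + s + \<delta>)"
    using \<open>0 \<le> s'\<close> \<open>z \<in> X\<close> \<open>0 \<le> s\<close> \<open>0 < \<delta>\<close> by (intro is_sup_on_least[OF sup]) auto
  then show False using \<open>0 \<le> s'\<close> \<open>0 < \<delta>\<close> by simp
qed

text \<open>Negative \<open>c\<close> is allowed, since all radii in \<open>D\<close> are at least
  \<open>s\<close>. Completeness gives the translated family a supremum \<open>(z, s')\<close> below
  \<open>(x, s + c)\<close>; \<open>ball_sup_radius\<close> forces \<open>s' = s + c\<close>, so
  translating back makes \<open>(z, s)\<close> an upper bound of \<open>D\<close>. Then
  \<open>x\<close> and \<open>z\<close> have distance 0 in both directions.\<close>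

lemma ball_sup_shift:
  assumes D: "D \<subseteq> formal_balls X" "directed_on (ball_le d) D" and sup: "ball_sup D (x, s)"
    and c: "0 \<le> s + c"
  shows "ball_shift c D \<subseteq> formal_balls X" and "ball_sup (ball_shift c D) (x, s + c)"
proof -
  let ?D = "ball_shift c D"
  have ub: "ball_le d p (x, s)" if "p \<in> D" for p
    by (rule is_sup_on_upper[OF sup that])
  have x: "x \<in> X" "0 \<le> s" using sup by (auto simp: is_sup_on_def)
  show sub: "?D \<subseteq> formal_balls X"
    using D(1) c ub by (force simp: ball_shift_def)
  obtain z s' where z: "ball_sup ?D (z, s')"
    by (metis ball_sup_exists D(2) sub directed_ball_shift surj_pair)
  then have zX: "z \<in> X" "0 \<le> s'" by (simp_all add: is_sup_on_def)
  have ub': "ball_le d (y, t + c) (z, s')" if "(y, t) \<in> D" for y t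
  proof -
    have "(y, t + c) \<in> ?D" using that by simp
    then show ?thesis using z unfolding is_sup_on_def by blast
  qed
  have "ball_le d p (x, s + c)" if "p \<in> ?D" for p
    using that ub by (cases p) (force simp: algebra_simps)
  then have zx: "ball_le d (z, s') (x, s + c)"
    using x c by (intro is_sup_on_least[OF z]) auto
  moreover have "s' \<le> s + c"
  proof (rule field_le_epsilon)
    fix e :: real assume "0 < e"
    then obtain y t where "(y, t) \<in> D" "t < s + e"
      using ball_sup_radius[OF D sup] by blast
    with ub'[of y t] show "s' \<le> s + c + e" by simp
  qed
  ultimately have s': "s' = s + c" by simp
  have "ball_le d p (z, s)" if "p \<in> D" for p
    using ub'[of "fst p" "snd p"] that s' by (cases p) simp
  then have "ball_le d (x, s) (z, s)"
    using zX x by (intro is_sup_on_least[OF sup]) auto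
  then have "x = z"
    using zx s' quasi_metricD(3)[OF quasi_metric] x zX by simp
  then show "ball_sup ?D (x, s + c)"
    using z s' by simp
qed

lemma ball_open_radius: "ball_open {(x, r). (x, r) \<in> formal_balls X \<and> r < a}"
proof (rule scott_open_onI, goal_cases)
  case (3 D p)
  then obtain x s where "p = (x, s)" "s < a" "ball_sup D (x, s)" by auto
  then obtain y t where "(y, t) \<in> D" "t < a"
    using ball_sup_radius[of D x s "a - s"] 3 by auto
  then show ?case using 3(1) by (intro bexI[of _ "(y, t)"]) auto
qed auto

lemma ball_open_shift:
  assumes U: "ball_open U" and c: "0 \<le> c"
  shows "ball_open {(x, r). (x, r) \<in> formal_balls X \<and> (x, r + c) \<in> U}"
proof (rule scott_open_onI, goal_cases)
  case (2 p q)
  then obtain x r y s where "p = (x, r)" "q = (y, s)" by (metis surj_pair)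
  then show ?case
    using 2 c ball_openD[OF U, of "(x, r + c)" "(y, s + c)"] by auto
next
  case (3 D p)
  then obtain x s where p: "p = (x, s)" "0 \<le> s" "(x, s + c) \<in> U" by auto
  have "ball_sup (ball_shift c D) (x, s + c)" "ball_shift c D \<subseteq> formal_balls X"
    using ball_sup_shift[OF 3(1,2), of x s c] 3(3) p c by auto
  then obtain q where "q \<in> ball_shift c D" "q \<in> U"
    using scott_open_onD(3)[OF U _ directed_ball_shift[OF 3(2)]] p by blast
  then obtain y t where "(y, t) \<in> D" "(y, t + c) \<in> U" by (auto simp: ball_shift_def)
  then show ?case using 3(1) by (intro bexI[of _ "(y, t)"]) auto
qed auto

text \<open>Balls of radius below \<open>c\<close> cannot be lowered by \<open>c\<close>; admitting
  all of them keeps the set upward closed, and by \<open>ball_sup_radius\<close> a supremum of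
  radius below \<open>c\<close> is detected by a member.\<close>

lemma ball_open_unshift:
  assumes U: "ball_open U" and c: "0 \<le> c"
  shows "ball_open {(x, r). (x, r) \<in> formal_balls X \<and> (r < c \<or> (x, r - c) \<in> U)}"
proof (rule scott_open_onI, goal_cases)
  case (2 p q)
  then obtain x r y s where "p = (x, r)" "q = (y, s)" by (metis surj_pair)
  then show ?case
    using 2 c ball_openD[OF U, of "(x, r - c)" "(y, s - c)"] by (cases "s < c") auto
next
  case (3 D p)
  then obtain x s where p: "p = (x, s)" "0 \<le> s" by auto
  show ?case
  proof (cases "s < c")
    case True
    then obtain y t where "(y, t) \<in> D" "t < c"
      using ball_sup_radius[of D x s "c - s"] 3 p by auto
    then show ?thesis using 3(1) by (intro bexI[of _ "(y, t)"]) auto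
  next
    case False
    then have "(x, s - c) \<in> U" "0 \<le> s - c" using 3 p by auto
    moreover have "ball_sup (ball_shift (- c) D) (x, s - c)" "ball_shift (- c) D \<subseteq> formal_balls X"
      using ball_sup_shift[OF 3(1,2), of x s "- c"] 3(3) p False by auto
    ultimately obtain q where "q \<in> ball_shift (- c) D" "q \<in> U"
      using scott_open_onD(3)[OF U _ directed_ball_shift[OF 3(2)]] by blast
    then obtain y t where "(y, t) \<in> D" "(y, t - c) \<in> U" by (auto simp: ball_shift_def)
    then show ?thesis using 3(1) by (intro bexI[of _ "(y, t)"]) auto
  qed
qed auto

lemma ball_open_not_below:
  assumes "p \<in> formal_balls X"
  shows "ball_open {q \<in> formal_balls X. \<not> ball_le d q p}"
proof (rule scott_open_onI, goal_cases)
  case (2 a b)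
  then show ?case using ball_le_trans[OF quasi_metric, of a b p] assms by auto
next
  case (3 D s)
  then have "\<not> (\<forall>a\<in>D. ball_le d a p)"
    using is_sup_on_least[OF 3(3) assms] by auto
  then show ?case using 3(1) by auto
qed auto

text \<open>\<open>(x, s)\<close> is the supremum of the chain of balls
  \<open>(x, s + \<eta>)\<close> with \<open>\<eta> > 0\<close>, so an open set that contains it
  meets the chain.\<close>

lemma ball_open_room:
  assumes U: "ball_open U" and x: "(x, s) \<in> U"
  obtains \<eta> where "0 < \<eta>" "(x, s + \<eta>) \<in> U"
proof -
  let ?D = "(\<lambda>\<eta>. (x, s + \<eta>)) ` {0<..}"
  have xX: "x \<in> X" "0 \<le> s" using scott_open_onD(1)[OF U] x by auto
  have "directed_on (ball_le d) ?D"
    unfolding directed_on_def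
  proof (intro conjI ballI)
    fix p q assume "p \<in> ?D" "q \<in> ?D"
    then obtain a b where "p = (x, s + a)" "q = (x, s + b)" "0 < a" "0 < b" by auto
    then show "\<exists>u\<in>?D. ball_le d p u \<and> ball_le d q u"
      using quasi_metricD(1)[OF quasi_metric] xX by (intro bexI[of _ "(x, s + min a b)"]) auto
  qed auto
  moreover have "?D \<subseteq> formal_balls X" using xX by auto
  moreover have "ball_sup ?D (x, s)"
    unfolding is_sup_on_def
  proof (intro conjI ballI impI)
    fix u assume "u \<in> formal_balls X" and ub: "\<forall>a\<in>?D. ball_le d a u"
    obtain y t where u: "u = (y, t)" by fastforce
    have *: "t \<le> s + e" "d x y \<le> ennreal (s + e - t)" if "0 < e" for e
      using ub u that by auto
    have "t \<le> s" using *(1) by (rule field_le_epsilon)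
    moreover have "d x y \<le> ennreal (s - t)"
    proof (rule ennreal_le_epsilon)
      fix e :: real assume "0 < e"
      then show "d x y \<le> ennreal (s - t) + ennreal e"
        using *(2)[of e] \<open>t \<le> s\<close> by (simp flip: ennreal_plus add: algebra_simps)
    qed
    ultimately show "ball_le d (x, s) u" by (simp add: u)
  qed (use xX quasi_metricD(1)[OF quasi_metric] in auto)
  ultimately show ?thesis
    using scott_open_onD(3)[OF U _ _ _ x, of ?D] that by auto
qed

text \<open>The topology is defined by slices at height 0; moving an open set by \<open>r\<close>
  with \<open>ball_open_unshift\<close> or \<open>ball_open_shift\<close> shows that slices at any
  height give the same open sets. Tests on balls of radius \<open>r\<close> thus speak about the
  topology of \<open>X\<close>.\<close>

lemma openin_T_iff:
  assumes "0 \<le> r"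
  shows "openin T U \<longleftrightarrow> (\<exists>W. ball_open W \<and> U = {x \<in> X. (x, r) \<in> W})"
proof -
  have *: "openin T U \<longleftrightarrow> (\<exists>W. ball_open W \<and> U = {x \<in> X. (x, 0) \<in> W})" for U
    unfolding d_scott_topology_def openin_pullback_topology openin_scott_topology
    by (auto simp: vimage_def)
  show ?thesis
    unfolding *
  proof (intro iffI; elim exE conjE)
    fix W assume W: "ball_open W" "U = {x \<in> X. (x, 0) \<in> W}"
    then show "\<exists>W. ball_open W \<and> U = {x \<in> X. (x, r) \<in> W}"
      using ball_open_unshift[OF W(1) assms] assms
      by (intro exI[of _ "{(x, s). (x, s) \<in> formal_balls X \<and> (s < r \<or> (x, s - r) \<in> W)}"]) auto
  next
    fix W assume W: "ball_open W" "U = {x \<in> X. (x, r) \<in> W}"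
    then show "\<exists>W. ball_open W \<and> U = {x \<in> X. (x, 0) \<in> W}"
      using ball_open_shift[OF W(1) assms] assms
      by (intro exI[of _ "{(x, s). (x, s) \<in> formal_balls X \<and> (x, s + r) \<in> W}"]) auto
  qed
qed

lemma openin_T_trace: "ball_open W \<Longrightarrow> 0 \<le> r \<Longrightarrow> openin T {x \<in> X. (x, r) \<in> W}"
  using openin_T_iff by blast

lemma topspace_T [simp]: "topspace T = X"
proof
  have "openin T X"
    using openin_T_trace[OF ball_open_all, of 0] by simp
  then show "X \<subseteq> topspace T" by (rule openin_subset)
  show "topspace T \<subseteq> X"
    using openin_T_iff[of 0 "topspace T"] by auto
qed

section \<open>Compactness at a fixed radius\<close>

lemma compact_cover:
  assumes Q: "compactin T Q" and r: "0 \<le> r" and K: "\<And>i. i \<in> I \<Longrightarrow> ball_open (K i)"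
    and cov: "\<And>x. x \<in> Q \<Longrightarrow> \<exists>i\<in>I. (x, r) \<in> K i"
  obtains J where "finite J" "J \<subseteq> I" "\<And>x. x \<in> Q \<Longrightarrow> \<exists>i\<in>J. (x, r) \<in> K i"
proof -
  let ?f = "\<lambda>i. {x \<in> X. (x, r) \<in> K i}"
  have "Q \<subseteq> X" using compactin_subset_topspace[OF Q] by simp
  have "Q \<subseteq> \<Union>(?f ` I)"
  proof
    fix x assume "x \<in> Q"
    then obtain i where "i \<in> I" "(x, r) \<in> K i" "x \<in> X" using cov[of x] \<open>Q \<subseteq> X\<close> by auto
    then show "x \<in> \<Union>(?f ` I)" by auto
  qed
  moreover have "\<forall>V\<in>?f ` I. openin T V" using K r openin_T_trace by blast
  ultimately have "\<exists>\<G>. finite \<G> \<and> \<G> \<subseteq> ?f ` I \<and> Q \<subseteq> \<Union>\<G>"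
    using Q unfolding compactin_def by (elim conjE allE[of _ "?f ` I"] impE) simp_all
  then obtain \<G> where \<G>: "finite \<G>" "\<G> \<subseteq> ?f ` I" "Q \<subseteq> \<Union>\<G>"
    by blast
  obtain J where J: "J \<subseteq> I" "finite J" "\<G> = ?f ` J"
    using finite_subset_image[OF \<G>(1,2)] by blast
  show ?thesis
  proof (rule that[OF J(2,1)])
    show "\<exists>i\<in>J. (x, r) \<in> K i" if "x \<in> Q" for x
      using that \<G>(3) J(3) by auto
  qed
qed

text \<open>Compactness makes the slack of \<open>ball_open_room\<close> uniform: the sets of balls
  that stay in \<open>U\<close> when enlarged by some \<open>\<eta> > 0\<close> form a cover, and
  the smallest of finitely many values works throughout.\<close>

lemma compact_room:
  assumes Q: "compactin T Q" and U: "ball_open U" and r: "0 \<le> r" and sub: "\<And>x. x \<in> Q \<Longrightarrow> (x, r) \<in> U"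
  obtains \<eta> where "0 < \<eta>" "\<And>x. x \<in> Q \<Longrightarrow> (x, r + \<eta>) \<in> U"
proof -
  let ?f = "\<lambda>\<eta>. {(x, s). (x, s) \<in> formal_balls X \<and> (x, s + \<eta>) \<in> U}"
  have QX: "Q \<subseteq> X" using compactin_subset_topspace[OF Q] by simp
  have "\<exists>\<eta>\<in>{0<..}. (x, r) \<in> ?f \<eta>" if x: "x \<in> Q" for x
  proof -
    obtain \<eta> where "0 < \<eta>" "(x, r + \<eta>) \<in> U" by (rule ball_open_room[OF U sub[OF x]])
    then show ?thesis using QX x r by (intro bexI[of _ \<eta>]) auto
  qed
  moreover have "ball_open (?f \<eta>)" if "\<eta> \<in> {0<..}" for \<eta>
    using that by (intro ball_open_shift[OF U]) simp
  ultimately obtain N where N: "finite N" "N \<subseteq> {0<..}" "\<And>x. x \<in> Q \<Longrightarrow> \<exists>\<eta>\<in>N. (x, r) \<in> ?f \<eta>"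
    using compact_cover[OF Q r, of "{0<..}" ?f] by blast
  \<comment> \<open>The extra 1 keeps the minimum defined when \<open>N\<close> is empty.\<close>
  define \<eta> where "\<eta> = Min (insert 1 N)"
  have "0 < \<eta>" using N by (auto simp: \<eta>_def)
  moreover have "(x, r + \<eta>) \<in> U" if x: "x \<in> Q" for x
  proof -
    obtain \<eta>' where e: "\<eta>' \<in> N" "(x, r + \<eta>') \<in> U" "x \<in> X" using N(3)[OF x] by auto
    have "\<eta> \<le> \<eta>'" using N e by (auto simp: \<eta>_def)
    then have "ball_le d (x, r + \<eta>') (x, r + \<eta>)"
      using e quasi_metricD(1)[OF quasi_metric] by simp
    then show ?thesis
      using ball_openD[OF U e(2)] e r \<open>0 < \<eta>\<close> by simp
  qed
  ultimately show ?thesis using that by auto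
qed

section \<open>Lipschitz continuous maps\<close>

text \<open>Preimages of the sets of \<open>d_real_superlevel_open\<close>. The offset
  \<open>c\<close> is kept because \<open>lens_ball_leI\<close> uses levels that may be
  negative.\<close>

lemma lipschitz1_continuousD:
  assumes h: "h \<in> lipschitz1_continuous X d" and "0 \<le> a" "0 \<le> c"
  shows "ball_open {(x, s). (x, s) \<in> formal_balls X \<and> ennreal (a + s) < h x + ennreal c}"
proof -
  let ?W = "{(t, s). 0 \<le> s \<and> ennreal (a + s) < t + ennreal c}"
  have "openin (ball_topology UNIV d_real) ?W"
    unfolding openin_scott_topology by (rule d_real_superlevel_open) fact+
  then have "openin (ball_topology X d) {p \<in> topspace (ball_topology X d). (case p of (x, r) \<Rightarrow> (h x, r)) \<in> ?W}"
    using h unfolding lipschitz1_continuous_def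
    by (intro openin_continuous_map_preimage[of _ "ball_topology UNIV d_real"]) simp_all
  moreover have "{p \<in> topspace (ball_topology X d). (case p of (x, r) \<Rightarrow> (h x, r)) \<in> ?W} =
    {(x, s). (x, s) \<in> formal_balls X \<and> ennreal (a + s) < h x + ennreal c}"
    by auto
  ultimately show ?thesis by (simp only: openin_scott_topology)
qed

lemma lipschitz1_continuousI:
  assumes h: "\<And>a. 0 \<le> a \<Longrightarrow> ball_open {(x, s). (x, s) \<in> formal_balls X \<and> ennreal (a + s) < h x}"
  shows "h \<in> lipschitz1_continuous X d"
proof -
  have mono: "h x \<le> h y + ennreal (s - t)"
    if "(x, s) \<in> formal_balls X" "(y, t) \<in> formal_balls X" "ball_le d (x, s) (y, t)" for x s y t
  proof (rule ccontr)
    assume lt: "\<not> ?thesis"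
    then have "h y \<noteq> \<infinity>" by auto
    then obtain a where a: "h y = ennreal a" "0 \<le> a" by (cases "h y") auto
    then have "ennreal (a + (s - t)) < h x" using lt that by (simp add: not_le)
    then have "(x, s - t) \<in> {(x, s). (x, s) \<in> formal_balls X \<and> ennreal (a + s) < h x}"
      using that by (simp del: ennreal_plus)
    then have "(y, 0) \<in> {(x, s). (x, s) \<in> formal_balls X \<and> ennreal (a + s) < h x}"
      using that by (elim ball_openD[OF h[OF a(2)]]) simp_all
    then show False using a by simp
  qed
  let ?f = "\<lambda>(x, r). (h x, r)"
  have "ball_open {p \<in> formal_balls X. ?f p \<in> W}"
    if W: "scott_open_on (formal_balls UNIV) (ball_le d_real) W" for W
  proof (rule scott_open_onI, goal_cases)
    case (2 p q)
    then obtain x s y t where pq: "p = (x, s)" "q = (y, t)" by (metis surj_pair)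
    then have "(h x, s) \<in> W" "ball_le d_real (h x, s) (h y, t)" "(h y, t) \<in> formal_balls UNIV"
      using 2 mono[of x s y t] by (auto simp: d_real_le_iff)
    then show ?case using pq 2 scott_open_onD(2)[OF W] by simp
  next
    case (3 D p)
    obtain x s where p: "p = (x, s)" by fastforce
    have D: "D \<subseteq> formal_balls X" "directed_on (ball_le d) D" and sup: "ball_sup D (x, s)"
      and xs: "(x, s) \<in> formal_balls X" "(h x, s) \<in> W"
      using 3 p by auto
    have fmono: "ball_le d_real (?f p) (?f q)"
      if "p \<in> formal_balls X" "q \<in> formal_balls X" "ball_le d p q" for p q
      using that mono by (cases p, cases q) (auto simp: d_real_le_iff)
    have dir: "directed_on (ball_le d_real) (?f ` D)"
      unfolding directed_on_def
    proof (intro conjI ballI)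
      show "?f ` D \<noteq> {}" using D by (auto simp: directed_on_def)
    next
      fix a b assume "a \<in> ?f ` D" "b \<in> ?f ` D"
      then obtain p q where pq: "a = ?f p" "b = ?f q" "p \<in> D" "q \<in> D" by blast
      then obtain u where "u \<in> D" "ball_le d p u" "ball_le d q u"
        using D(2) unfolding directed_on_def by blast
      then show "\<exists>c\<in>?f ` D. ball_le d_real a c \<and> ball_le d_real b c"
        using pq D(1) fmono by (intro bexI[of _ "?f u"]) blast+
    qed
    have sub: "?f ` D \<subseteq> formal_balls UNIV" using D(1) by auto
    have "is_sup_on (formal_balls UNIV) (ball_le d_real) (?f ` D) (h x, s)"
      unfolding is_sup_on_def
    proof (intro conjI ballI impI)
      show "(h x, s) \<in> formal_balls UNIV" using xs by simp
      show "ball_le d_real a (h x, s)" if a: "a \<in> ?f ` D" for a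
      proof -
        obtain p where "p \<in> D" "a = ?f p" using a by blast
        then show ?thesis
          using fmono[of p "(x, s)"] is_sup_on_upper[OF sup] xs D(1) by auto
      qed
    next
      fix w assume w: "w \<in> formal_balls UNIV" "\<forall>a\<in>?f ` D. ball_le d_real a w"
      obtain u v where uv: "w = (u, v)" "0 \<le> v" using w by (cases w) auto
      have ub: "v \<le> t" "h y \<le> u + ennreal (t - v)" if "(y, t) \<in> D" for y t
        using w(2) that uv by (force simp: d_real_le_iff)+
      have "v \<le> s"
      proof (rule field_le_epsilon)
        fix e :: real assume "0 < e"
        then show "v \<le> s + e" using ball_sup_radius[OF D sup, of e] ub(1) by force
      qed
      \<comment> \<open>If this failed, lowering \<open>D\<close> by \<open>v\<close> would put its
        supremum into the superlevel set at \<open>a\<close>, the finite value of \<open>u\<close>;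
        a member \<open>(y, t - v)\<close> in that set violates the bound on
        \<open>h y\<close>.\<close>
      moreover have "h x \<le> u + ennreal (s - v)"
      proof (rule ccontr)
        assume lt: "\<not> ?thesis"
        then have "u \<noteq> \<infinity>" by auto
        then obtain a where a: "u = ennreal a" "0 \<le> a" by (cases u) auto
        have "ennreal (a + (s - v)) < h x" using lt a \<open>v \<le> s\<close> by (simp add: not_le)
        then have mem: "(x, s + - v) \<in> {(x, s). (x, s) \<in> formal_balls X \<and> ennreal (a + s) < h x}"
          using xs \<open>v \<le> s\<close> by simp
        have "0 \<le> s + - v" using \<open>v \<le> s\<close> by simp
        note sh = ball_sup_shift[OF D sup this]
        obtain q where "q \<in> ball_shift (- v) D"
          "q \<in> {(x, s). (x, s) \<in> formal_balls X \<and> ennreal (a + s) < h x}"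
          using scott_open_onD(3)[OF h[OF a(2)] sh(1) directed_ball_shift[OF D(2)] sh(2) mem] by blast
        then obtain y t where "(y, t) \<in> D" "ennreal (a + (t - v)) < h y"
          by (auto simp: ball_shift_def)
        then show False using ub[of y t] a by simp
      qed
      ultimately show "ball_le d_real (h x, s) w" by (simp add: uv d_real_le_iff)
    qed
    then obtain a where "a \<in> ?f ` D" "a \<in> W"
      using scott_open_onD(3)[OF W sub dir _ xs(2)] by blast
    then show ?case using D(1) by auto
  qed auto
  then show ?thesis
    unfolding lipschitz1_continuous_def continuous_map
    by (auto simp: openin_scott_topology)
qed

text \<open>The supremum below is the distance from the ball \<open>(z, \<rho>)\<close> to the complement of \<open>U\<close>;
  such functions turn a bound on \<^const>\<open>d_P\<close> into a statement about arbitrary Scott-open sets.\<close>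

lemma lipschitz1_continuous_depth:
  assumes U: "ball_open U" and \<rho>: "0 \<le> \<rho>"
  shows "(\<lambda>z. SUP t\<in>{t. 0 \<le> t \<and> (z, \<rho> + t) \<in> U}. ennreal t) \<in> lipschitz1_continuous X d"
proof (rule lipschitz1_continuousI)
  fix a :: real assume a: "0 \<le> a"
  have "ennreal (a + s) < (SUP t\<in>{t. 0 \<le> t \<and> (x, \<rho> + t) \<in> U}. ennreal t) \<longleftrightarrow> (x, s + (\<rho> + a)) \<in> U"
    if xs: "(x, s) \<in> formal_balls X" for x s
  proof
    assume "ennreal (a + s) < (SUP t\<in>{t. 0 \<le> t \<and> (x, \<rho> + t) \<in> U}. ennreal t)"
    then obtain t where t: "(x, \<rho> + t) \<in> U" "a + s < t"
      using a xs unfolding less_SUP_iff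
      by (auto simp: ennreal_less_iff simp del: ennreal_plus)
    then show "(x, s + (\<rho> + a)) \<in> U"
      using a \<rho> xs quasi_metricD(1)[OF quasi_metric]
      by (intro ball_openD[OF U t(1)]) auto
  next
    assume "(x, s + (\<rho> + a)) \<in> U"
    then obtain \<eta> where "0 < \<eta>" "(x, s + (\<rho> + a) + \<eta>) \<in> U"
      by (rule ball_open_room[OF U])
    then show "ennreal (a + s) < (SUP t\<in>{t. 0 \<le> t \<and> (x, \<rho> + t) \<in> U}. ennreal t)"
      using a xs unfolding less_SUP_iff
      by (intro bexI[of _ "a + s + \<eta>"])
        (auto simp: ennreal_less_iff algebra_simps simp del: ennreal_plus)
  qed
  then have "{(x, s). (x, s) \<in> formal_balls X \<and> ennreal (a + s) < (SUP t\<in>{t. 0 \<le> t \<and> (x, \<rho> + t) \<in> U}. ennreal t)}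
    = {(x, s). (x, s) \<in> formal_balls X \<and> (x, s + (\<rho> + a)) \<in> U}"
    by blast
  then show "ball_open {(x, s). (x, s) \<in> formal_balls X \<and> ennreal (a + s) < (SUP t\<in>{t. 0 \<le> t \<and> (x, \<rho> + t) \<in> U}. ennreal t)}"
    using ball_open_shift[OF U, of "\<rho> + a"] a \<rho> by simp
qed

end

section \<open>The ordering of formal balls of quasi-lenses\<close>

definition fb_box :: "('a set \<times> 'a set) \<times> real \<Rightarrow> ('a \<times> real) set \<Rightarrow> bool" where
  "fb_box = (\<lambda>((Q, C), r) U. \<forall>x\<in>Q. (x, r) \<in> U)"

definition fb_dia :: "('a set \<times> 'a set) \<times> real \<Rightarrow> ('a \<times> real) set \<Rightarrow> bool" where
  "fb_dia = (\<lambda>((Q, C), r) U. \<exists>x\<in>C. (x, r) \<in> U)"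

lemma fb_box_iff [simp]: "fb_box ((Q, C), r) U \<longleftrightarrow> (\<forall>x\<in>Q. (x, r) \<in> U)"
  by (simp add: fb_box_def)

lemma fb_dia_iff [simp]: "fb_dia ((Q, C), r) U \<longleftrightarrow> (\<exists>x\<in>C. (x, r) \<in> U)"
  by (simp add: fb_dia_def)

lemma fb_box_mono: "fb_box \<beta> U \<Longrightarrow> U \<subseteq> V \<Longrightarrow> fb_box \<beta> V"
  by (auto simp: fb_box_def split: prod.splits)

lemma fb_dia_mono: "fb_dia \<beta> U \<Longrightarrow> U \<subseteq> V \<Longrightarrow> fb_dia \<beta> V"
  by (auto simp: fb_dia_def split: prod.splits)

context yoneda_space
begin

lemma quasi_lensD:
  assumes "(Q, C) \<in> quasi_lenses X d"
  shows "compactin T Q" "up_closure X d Q = Q" "closedin T C" "Q \<inter> C \<noteq> {}"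
    "Q \<subseteq> up_closure X d (Q \<inter> C)" "\<And>U. openin T U \<Longrightarrow> Q \<subseteq> U \<Longrightarrow> C \<subseteq> T closure_of (U \<inter> C)"
    "Q \<subseteq> X" "C \<subseteq> X"
proof -
  show "compactin T Q" "up_closure X d Q = Q" "closedin T C" "Q \<inter> C \<noteq> {}"
    "Q \<subseteq> up_closure X d (Q \<inter> C)" "\<And>U. openin T U \<Longrightarrow> Q \<subseteq> U \<Longrightarrow> C \<subseteq> T closure_of (U \<inter> C)"
    using assms unfolding quasi_lenses_def by auto
  then show "Q \<subseteq> X" "C \<subseteq> X"
    using compactin_subset_topspace closedin_subset by fastforce+
qed

lemma d_P_le_iff:
  "d_P X d (Q, C) (Q', C') \<le> ennreal c \<longleftrightarrow> (\<forall>h\<in>lipschitz1_continuous X d.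
     (INF x\<in>Q. h x) \<le> (INF x\<in>Q'. h x) + ennreal c \<and> (SUP x\<in>C. h x) \<le> (SUP x\<in>C'. h x) + ennreal c)"
  by (auto simp: d_P_def d_Q_def d_H_def SUP_le_iff d_real_le_iff)

text \<open>Depth in \<open>U\<close> is measured from height \<open>r'\<close>, so that positive
  depth at \<open>y\<close> gives \<open>(y, r') \<in> U\<close>. Slack \<open>\<eta>\<close> at
  height \<open>r\<close> means depth at least \<open>r - r' + \<eta>\<close>; the bound on the
  distance loses at most \<open>r - r'\<close>, and \<open>\<eta>\<close> survives. For the box the
  slack must be uniform over \<open>Q\<close>, which is where compactness is used.\<close>

lemma lens_ball_le_imp:
  assumes L: "(Q, C) \<in> quasi_lenses X d" "(Q', C') \<in> quasi_lenses X d" and r: "0 \<le> r'"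
    and le: "ball_le (d_P X d) ((Q, C), r) ((Q', C'), r')" and U: "ball_open U"
  shows "fb_box ((Q, C), r) U \<Longrightarrow> fb_box ((Q', C'), r') U"
    and "fb_dia ((Q, C), r) U \<Longrightarrow> fb_dia ((Q', C'), r') U"
proof -
  define h where "h = (\<lambda>z. SUP t\<in>{t. 0 \<le> t \<and> (z, r' + t) \<in> U}. ennreal t)"
  have h: "h \<in> lipschitz1_continuous X d"
    unfolding h_def by (rule lipschitz1_continuous_depth) fact+
  have rr: "r' \<le> r" and "d_P X d (Q, C) (Q', C') \<le> ennreal (r - r')"
    using le by simp_all
  then have Q: "(INF x\<in>Q. h x) \<le> (INF x\<in>Q'. h x) + ennreal (r - r')"
    and C: "(SUP x\<in>C. h x) \<le> (SUP x\<in>C'. h x) + ennreal (r - r')"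
    using h unfolding d_P_le_iff by blast+
  have pos: "(y, r') \<in> U" if hy: "0 < h y" and y: "y \<in> X" for y
  proof -
    obtain t where t: "0 < t" "(y, r' + t) \<in> U"
      using hy unfolding h_def less_SUP_iff by auto
    then show ?thesis
      using y r quasi_metricD(1)[OF quasi_metric] by (intro ball_openD[OF U t(2)]) auto
  qed
  have depth: "ennreal (r - r' + \<eta>) \<le> h x" if "(x, r + \<eta>) \<in> U" "0 < \<eta>" for x \<eta>
    unfolding h_def using that rr by (intro SUP_upper2[of "r - r' + \<eta>"]) auto
  show "fb_box ((Q', C'), r') U" if box: "fb_box ((Q, C), r) U"
  proof -
    obtain \<eta> where \<eta>: "0 < \<eta>" "\<And>x. x \<in> Q \<Longrightarrow> (x, r + \<eta>) \<in> U"
      using compact_room[OF quasi_lensD(1)[OF L(1)] U, of r] box r rr by auto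
    then have "ennreal (r - r' + \<eta>) \<le> (INF x\<in>Q. h x)"
      using depth by (intro INF_greatest) auto
    moreover have "ennreal (r - r' + \<eta>) = ennreal \<eta> + ennreal (r - r')"
      using \<eta>(1) rr by (simp add: add.commute)
    ultimately have "ennreal \<eta> + ennreal (r - r') \<le> (INF x\<in>Q'. h x) + ennreal (r - r')"
      using Q by (metis order_trans)
    then have "ennreal \<eta> \<le> (INF x\<in>Q'. h x)" by simp
    then have "0 < h y" if "y \<in> Q'" for y
      using that \<eta>(1) by (metis INF_lower ennreal_less_zero_iff less_le_trans)
    then show ?thesis using pos quasi_lensD(7)[OF L(2)] by auto
  qed
  show "fb_dia ((Q', C'), r') U" if dia: "fb_dia ((Q, C), r) U"
  proof -
    obtain x where x: "x \<in> C" "(x, r) \<in> U" using dia by auto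
    obtain \<eta> where \<eta>: "0 < \<eta>" "(x, r + \<eta>) \<in> U" by (rule ball_open_room[OF U x(2)])
    then have "ennreal (r - r' + \<eta>) \<le> (SUP x\<in>C. h x)"
      using depth x(1) by (intro SUP_upper2) auto
    moreover have "ennreal (r - r' + \<eta>) = ennreal \<eta> + ennreal (r - r')"
      using \<eta>(1) rr by (simp add: add.commute)
    ultimately have "ennreal \<eta> + ennreal (r - r') \<le> (SUP x\<in>C'. h x) + ennreal (r - r')"
      using C by (metis order_trans)
    then have "ennreal \<eta> \<le> (SUP x\<in>C'. h x)" by simp
    then have "0 < (SUP x\<in>C'. h x)"
      using \<eta>(1) by (metis ennreal_less_zero_iff less_le_trans)
    then obtain y where "y \<in> C'" "0 < h y" by (auto simp: less_SUP_iff)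
    then show ?thesis using pos quasi_lensD(8)[OF L(2)] by auto
  qed
qed

lemma lens_ball_leI:
  assumes L: "(Q, C) \<in> quasi_lenses X d" "(Q', C') \<in> quasi_lenses X d" and r: "0 \<le> r" "0 \<le> r'"
    and box: "\<And>U. ball_open U \<Longrightarrow> fb_box ((Q, C), r) U \<Longrightarrow> fb_box ((Q', C'), r') U"
    and dia: "\<And>U. ball_open U \<Longrightarrow> fb_dia ((Q, C), r) U \<Longrightarrow> fb_dia ((Q', C'), r') U"
  shows "ball_le (d_P X d) ((Q, C), r) ((Q', C'), r')"
proof -
  have rr: "r' \<le> r"
  proof (rule field_le_epsilon)
    fix e :: real assume "0 < e"
    then have "fb_box ((Q, C), r) {(x, s). (x, s) \<in> formal_balls X \<and> s < r + e}"
      using quasi_lensD(7)[OF L(1)] r by auto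
    then have "fb_box ((Q', C'), r') {(x, s). (x, s) \<in> formal_balls X \<and> s < r + e}"
      using box[OF ball_open_radius] by blast
    then show "r' \<le> r + e" using quasi_lensD(4)[OF L(2)] by auto
  qed
  have S: "ball_open {(x, s). (x, s) \<in> formal_balls X \<and> ennreal (a + s) < h x + ennreal r}"
    if "h \<in> lipschitz1_continuous X d" "0 \<le> a" for h a
    using that r by (intro lipschitz1_continuousD)
  have *: "(INF x\<in>Q. h x) \<le> h y + ennreal (r - r')"
    if h: "h \<in> lipschitz1_continuous X d" and y: "y \<in> Q'" for h y
  proof (rule ccontr)
    assume lt: "\<not> ?thesis"
    then have "h y \<noteq> \<infinity>" by auto
    then obtain b where b: "h y = ennreal b" "0 \<le> b" by (cases "h y") auto
    \<comment> \<open>Calibrated so that at height \<open>r\<close> it says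
      \<open>h x > b + (r - r')\<close> and at height \<open>r'\<close> it says
      \<open>h y > b\<close>, which fails for \<open>b = h y\<close>. Adding \<open>r\<close> on the
      right avoids negative levels. The same test serves for \<open>C\<close>, with \<open>b\<close>
      the supremum over \<open>C'\<close>.\<close>
    let ?S = "{(x, s). (x, s) \<in> formal_balls X \<and> ennreal (b + (r - r') + s) < h x + ennreal r}"
    have "fb_box ((Q, C), r) ?S"
    proof -
      have "ennreal (b + (r - r') + r) < h x + ennreal r" if "x \<in> Q" for x
      proof -
        have "ennreal (b + (r - r')) < h x"
          using lt b rr that by (auto simp: not_le intro: less_le_trans INF_lower)
        then have "ennreal (b + (r - r')) + ennreal r < h x + ennreal r"
          by (simp add: ennreal_add_left_cancel_less add.commute)
        then show ?thesis using ennreal_plus[of "b + (r - r')" r] b rr r by (simp del: ennreal_plus)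
      qed
      then show ?thesis using quasi_lensD(7)[OF L(1)] r by auto
    qed
    then have "fb_box ((Q', C'), r') ?S"
      using b rr by (intro box[OF S[OF h]]) simp_all
    then have "ennreal (b + (r - r') + r') < h y + ennreal r"
      using y by (simp del: ennreal_plus)
    then show False using b r by simp
  qed
  have Q: "(INF x\<in>Q. h x) \<le> (INF x\<in>Q'. h x) + ennreal (r - r')"
    if h: "h \<in> lipschitz1_continuous X d" for h
  proof -
    have "(INF x\<in>Q. h x) - ennreal (r - r') \<le> h y" if "y \<in> Q'" for y
      using h that *[of h y] by (simp add: ennreal_minus_le_iff add.commute)
    then have "(INF x\<in>Q. h x) - ennreal (r - r') \<le> (INF x\<in>Q'. h x)"
      by (rule INF_greatest)
    then show ?thesis by (simp add: ennreal_minus_le_iff add.commute)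
  qed
  have C: "(SUP x\<in>C. h x) \<le> (SUP x\<in>C'. h x) + ennreal (r - r')"
    if h: "h \<in> lipschitz1_continuous X d" for h
  proof (rule SUP_least, rule ccontr)
    fix y assume y: "y \<in> C" and lt: "\<not> h y \<le> (SUP x\<in>C'. h x) + ennreal (r - r')"
    then have "(SUP x\<in>C'. h x) \<noteq> \<infinity>"
      by (metis ennreal_add_eq_top infinity_ennreal_def top_greatest)
    then obtain b where b: "(SUP x\<in>C'. h x) = ennreal b" "0 \<le> b" by (cases "SUP x\<in>C'. h x") (auto simp del: SUP_eq_top_iff)
    let ?S = "{(x, s). (x, s) \<in> formal_balls X \<and> ennreal (b + (r - r') + s) < h x + ennreal r}"
    have "ennreal (b + (r - r')) < h y" using lt b rr by (simp add: not_le)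
    then have "ennreal (b + (r - r')) + ennreal r < h y + ennreal r"
      by (simp add: not_le ennreal_add_left_cancel_less add.commute)
    then have "ennreal (b + (r - r') + r) < h y + ennreal r"
      using ennreal_plus[of "b + (r - r')" r] b rr r by (simp del: ennreal_plus)
    then have "fb_dia ((Q, C), r) ?S"
      using y quasi_lensD(8)[OF L(1)] r by (auto simp del: ennreal_plus)
    then have "fb_dia ((Q', C'), r') ?S"
      using b rr by (intro dia[OF S[OF h]]) simp_all
    then obtain z where z: "z \<in> C'" "ennreal (b + (r - r') + r') < h z + ennreal r"
      by (auto simp del: ennreal_plus)
    have "h z \<le> ennreal b" using z(1) b by (metis SUP_upper)
    then have "h z + ennreal r \<le> ennreal b + ennreal r" by (rule add_right_mono)
    then show False using z(2) b r by simp
  qed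
  show ?thesis
    using Q C rr unfolding ball_le_iff d_P_le_iff by blast
qed

abbreviation "lens_balls \<equiv> formal_balls (quasi_lenses X d)"
abbreviation "lens_le \<equiv> ball_le (d_P X d)"

lemma lens_le_iff:
  assumes "\<beta> \<in> lens_balls" "\<gamma> \<in> lens_balls"
  shows "lens_le \<beta> \<gamma> \<longleftrightarrow>
    (\<forall>U. ball_open U \<longrightarrow> (fb_box \<beta> U \<longrightarrow> fb_box \<gamma> U) \<and> (fb_dia \<beta> U \<longrightarrow> fb_dia \<gamma> U))"
proof -
  obtain Q C r Q' C' r' where eq: "\<beta> = ((Q, C), r)" "\<gamma> = ((Q', C'), r')"
    by (metis surj_pair)
  then have "(Q, C) \<in> quasi_lenses X d" "(Q', C') \<in> quasi_lenses X d" "0 \<le> r" "0 \<le> r'"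
    using assms by simp_all
  then show ?thesis
    unfolding eq using lens_ball_le_imp[of Q C Q' C' r' r] lens_ball_leI[of Q C Q' C' r r'] by blast
qed

lemma quasi_metric_lenses: "quasi_metric (quasi_lenses X d) (d_P X d)"
  unfolding quasi_metric_def
proof (intro conjI ballI impI)
  fix L assume "L \<in> quasi_lenses X d"
  then have "lens_le (L, 0) (L, 0)" by (subst lens_le_iff) simp_all
  then show "d_P X d L L = 0" by simp
next
  fix L L' L'' :: "'a set \<times> 'a set"
  obtain Q C Q' C' Q'' C'' where eq: "L = (Q, C)" "L' = (Q', C')" "L'' = (Q'', C'')"
    by (metis surj_pair)
  have "d_Q X d Q Q'' \<le> d_Q X d Q Q' + d_Q X d Q' Q''"
    unfolding d_Q_def
  proof (rule SUP_least)
    fix h assume h: "h \<in> lipschitz1_continuous X d"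
    show "d_real (INF x\<in>Q. h x) (INF x\<in>Q''. h x)
      \<le> (SUP h\<in>lipschitz1_continuous X d. d_real (INF x\<in>Q. h x) (INF x\<in>Q'. h x))
        + (SUP h\<in>lipschitz1_continuous X d. d_real (INF x\<in>Q'. h x) (INF x\<in>Q''. h x))"
      by (rule order_trans[OF d_real_triangle[where y = "INF x\<in>Q'. h x"]])
        (intro add_mono SUP_upper h)
  qed
  moreover have "d_H X d C C'' \<le> d_H X d C C' + d_H X d C' C''"
    unfolding d_H_def
  proof (rule SUP_least)
    fix h assume h: "h \<in> lipschitz1_continuous X d"
    show "d_real (SUP x\<in>C. h x) (SUP x\<in>C''. h x)
      \<le> (SUP h\<in>lipschitz1_continuous X d. d_real (SUP x\<in>C. h x) (SUP x\<in>C'. h x))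
        + (SUP h\<in>lipschitz1_continuous X d. d_real (SUP x\<in>C'. h x) (SUP x\<in>C''. h x))"
      by (rule order_trans[OF d_real_triangle[where y = "SUP x\<in>C'. h x"]])
        (intro add_mono SUP_upper h)
  qed
  ultimately show "d_P X d L L'' \<le> d_P X d L L' + d_P X d L' L''"
    unfolding d_P_def eq prod.case
    by (intro max.boundedI) (erule order_trans, intro add_mono max.cobounded1 max.cobounded2)+
next
  \<comment> \<open>Distance 0 is the order at radius 0, and two tests separate: for
    \<open>x \<notin> Q\<close>, saturation puts \<open>Q\<close> at height 0 inside the open set of
    balls not below \<open>(x, 0)\<close>; and an open set tracing the complement of
    \<open>C'\<close> is met by any \<open>C\<close> not contained in \<open>C'\<close>.\<close>
  have *: "Q' \<subseteq> Q \<and> C \<subseteq> C'" if L: "(Q, C) \<in> quasi_lenses X d" "(Q', C') \<in> quasi_lenses X d"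
    and 0: "d_P X d (Q, C) (Q', C') = 0" for Q C Q' C'
  proof -
    have imp: "fb_box ((Q, C), 0) U \<longrightarrow> fb_box ((Q', C'), 0) U"
      "fb_dia ((Q, C), 0) U \<longrightarrow> fb_dia ((Q', C'), 0) U" if "ball_open U" for U
      using lens_ball_le_imp[OF L, of 0 0 U] 0 that by auto
    have "x \<in> Q" if x: "x \<in> Q'" for x
    proof (rule ccontr)
      assume "x \<notin> Q"
      have xX: "x \<in> X" using x quasi_lensD(7)[OF L(2)] by auto
      then have "d z x \<noteq> 0" if "z \<in> Q" for z
        using \<open>x \<notin> Q\<close> that quasi_lensD(2)[OF L(1)] by (auto simp: up_closure_def)
      then have "fb_box ((Q, C), 0) {q \<in> formal_balls X. \<not> ball_le d q (x, 0)}"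
        using quasi_lensD(7)[OF L(1)] by auto
      then have "fb_box ((Q', C'), 0) {q \<in> formal_balls X. \<not> ball_le d q (x, 0)}"
        using imp(1)[OF ball_open_not_below[of "(x, 0)"]] xX by simp
      then show False using x xX quasi_metricD(1)[OF quasi_metric] by auto
    qed
    moreover have "x \<in> C'" if x: "x \<in> C" for x
    proof (rule ccontr)
      assume "x \<notin> C'"
      have "openin T (X - C')" using quasi_lensD(3)[OF L(2)] by (simp add: closedin_def)
      then obtain W where W: "ball_open W" "X - C' = {x \<in> X. (x, 0) \<in> W}"
        using openin_T_iff[of 0] by auto
      have "x \<in> X - C'" using x \<open>x \<notin> C'\<close> quasi_lensD(8)[OF L(1)] by auto
      then have "fb_dia ((Q, C), 0) W" using x W(2) by auto
      then have "fb_dia ((Q', C'), 0) W" using imp(2)[OF W(1)] by simp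
      then show False using W(2) quasi_lensD(8)[OF L(2)] by auto
    qed
    ultimately show ?thesis by auto
  qed
  fix L L' assume "L \<in> quasi_lenses X d" "L' \<in> quasi_lenses X d"
    "d_P X d L L' = 0 \<and> d_P X d L' L = 0"
  then show "L = L'"
    using *[of "fst L" "snd L" "fst L'" "snd L'"] *[of "fst L'" "snd L'" "fst L" "snd L"]
    by (intro prod_eqI) auto
qed

lemma lens_sup_onI:
  assumes D: "D \<subseteq> lens_balls" and \<beta>: "\<beta> \<in> lens_balls"
    and box: "\<And>U. ball_open U \<Longrightarrow> fb_box \<beta> U \<longleftrightarrow> (\<exists>\<gamma>\<in>D. fb_box \<gamma> U)"
    and dia: "\<And>U. ball_open U \<Longrightarrow> fb_dia \<beta> U \<longleftrightarrow> (\<exists>\<gamma>\<in>D. fb_dia \<gamma> U)"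
  shows "is_sup_on lens_balls lens_le D \<beta>"
  unfolding is_sup_on_def
proof (intro conjI ballI impI)
  fix \<gamma> assume "\<gamma> \<in> D"
  then show "lens_le \<gamma> \<beta>"
    using D \<beta> box dia by (subst lens_le_iff) auto
next
  fix \<gamma> assume \<gamma>: "\<gamma> \<in> lens_balls" and ub: "\<forall>\<alpha>\<in>D. lens_le \<alpha> \<gamma>"
  have "fb_box \<alpha> U \<longrightarrow> fb_box \<gamma> U" "fb_dia \<alpha> U \<longrightarrow> fb_dia \<gamma> U" if "\<alpha> \<in> D" "ball_open U" for \<alpha> U
    using ub lens_le_iff[of \<alpha> \<gamma>] D \<gamma> that by blast+
  then show "lens_le \<beta> \<gamma>"
    using \<beta> \<gamma> box dia by (subst lens_le_iff) blast+
qed (fact \<beta>)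

section \<open>Sobriety and the Hofmann-Mislove theorem\<close>

text \<open>The strict counterpart of lying above \<open>(b, \<epsilon>)\<close>: truncation by
  \<open>ennreal\<close> makes the inequality imply \<open>s < \<epsilon>\<close>, and for
  \<open>\<epsilon> \<le> 0\<close> the set is empty. Center points are the points of
  \<open>X\<close> for which these sets are open.\<close>

definition way_above :: "'a \<times> real \<Rightarrow> ('a \<times> real) set" where
  "way_above = (\<lambda>(b, \<epsilon>). {(y, s). (y, s) \<in> formal_balls X \<and> d b y < ennreal (\<epsilon> - s)})"

lemma mem_way_above [simp]:
  "(y, s) \<in> way_above (b, \<epsilon>) \<longleftrightarrow> y \<in> X \<and> 0 \<le> s \<and> d b y < ennreal (\<epsilon> - s)"
  by (simp add: way_above_def)

lemma way_above_radius: "(y, s) \<in> way_above (b, \<epsilon>) \<Longrightarrow> s < \<epsilon>"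
proof (rule ccontr)
  assume "(y, s) \<in> way_above (b, \<epsilon>)" "\<not> s < \<epsilon>"
  then show False by (auto simp: ennreal_neg)
qed

lemma way_above_le: "q \<in> way_above p \<Longrightarrow> ball_le d p q"
  using way_above_radius by (cases p, cases q) (fastforce intro: less_imp_le)

lemma ball_open_way_above:
  assumes "center_point X d b"
  shows "ball_open (way_above (b, \<epsilon>))"
proof (cases "0 < \<epsilon>")
  case True
  then show ?thesis
    using assms by (simp add: center_point_def openin_scott_topology way_above_def)
next
  case False
  then have "way_above (b, \<epsilon>) = {}"
    using way_above_radius by force
  then show ?thesis by (simp add: ball_open_empty)
qed

lemma way_above_subset:
  assumes "ball_open U" "p \<in> U"
  shows "way_above p \<subseteq> U"
proof
  fix q assume q: "q \<in> way_above p"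
  then have "q \<in> formal_balls X" by (cases p, cases q) auto
  then show "q \<in> U" using ball_openD[OF assms] way_above_le[OF q] by blast
qed

end

locale algebraic_space = yoneda_space +
  fixes B :: "'a set"
  assumes strong_basis: "strong_basis X d B"
begin

lemma center: "b \<in> B \<Longrightarrow> center_point X d b"
  using strong_basis by (simp add: strong_basis_def)

lemma B_subset: "b \<in> B \<Longrightarrow> b \<in> X"
  using center by (auto simp: center_point_def)

lemma approx_by_center:
  assumes U: "ball_open U" and x: "(x, s) \<in> U" and \<delta>: "0 < \<delta>"
  obtains b t where "b \<in> B" "0 < t" "t < \<delta>" "d b x < ennreal t" "(b, s + t) \<in> U"
proof -
  have xs: "x \<in> X" "0 \<le> s" using scott_open_onD(1)[OF U] x by auto
  obtain \<eta>' where \<eta>': "0 < \<eta>'" "(x, s + \<eta>') \<in> U" by (rule ball_open_room[OF U x])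
  \<comment> \<open>The ball is enlarged by \<open>\<eta>\<close> before the basic family is
    translated to it: a member yields \<open>d b x \<le> u\<close>, and
    \<open>t = u + \<eta>\<close> is strictly larger. The bound \<open>\<delta> / 2\<close> keeps
    the enlarged radius below \<open>s + \<delta>\<close>.\<close>
  define \<eta> where "\<eta> = min \<eta>' (\<delta> / 2)"
  have \<eta>: "0 < \<eta>" "\<eta> \<le> \<delta> / 2" using \<eta>' \<delta> by (auto simp: \<eta>_def)
  have "(x, s + \<eta>) \<in> U"
    using xs \<eta> quasi_metricD(1)[OF quasi_metric]
    by (intro ball_openD[OF U \<eta>'(2)]) (auto simp: \<eta>_def)
  obtain D where D: "D \<subseteq> formal_balls B" "directed_on (ball_le d) D" "ball_sup D (x, 0)"
    using strong_basis xs unfolding strong_basis_def by blast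
  have DX: "D \<subseteq> formal_balls X" using D(1) B_subset by auto
  have c: "0 \<le> 0 + (s + \<eta>)" using xs \<eta> by simp
  let ?V = "U \<inter> {(y, t). (y, t) \<in> formal_balls X \<and> t < s + \<delta>}"
  have V: "ball_open ?V" by (intro ball_open_Int U ball_open_radius)
  have mem: "(x, 0 + (s + \<eta>)) \<in> ?V" using \<open>(x, s + \<eta>) \<in> U\<close> xs \<eta> \<delta> by simp
  note sh = ball_sup_shift[OF DX D(2,3) c]
  obtain q where "q \<in> ball_shift (s + \<eta>) D" "q \<in> ?V"
    using scott_open_onD(3)[OF V sh(1) directed_ball_shift[OF D(2)] sh(2) mem] by blast
  then obtain b u where b: "(b, u) \<in> D" "(b, u + (s + \<eta>)) \<in> U" "u + \<eta> < \<delta>"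
    by (auto simp: ball_shift_def)
  have "0 \<le> u" "b \<in> B" using b D(1) by auto
  moreover have "d b x \<le> ennreal u" using is_sup_on_upper[OF D(3) b(1)] by simp
  moreover have "ennreal u < ennreal (u + \<eta>)"
    using \<open>0 \<le> u\<close> \<eta> by (intro ennreal_lessI) auto
  ultimately have "d b x < ennreal (u + \<eta>)" by (metis le_less_trans)
  then show ?thesis
    using that[of b "u + \<eta>"] b \<eta> \<open>0 \<le> u\<close> \<open>b \<in> B\<close> by (simp add: ac_simps del: ennreal_plus)
qed

lemma interpolate_way_above:
  assumes U: "ball_open U" and x: "(x, s) \<in> U" and \<delta>: "0 < \<delta>"
  obtains b \<epsilon> where "b \<in> B" "\<epsilon> < s + \<delta>" "(x, s) \<in> way_above (b, \<epsilon>)" "(b, \<epsilon>) \<in> U"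
proof -
  obtain b t where "b \<in> B" "0 < t" "t < \<delta>" "d b x < ennreal t" "(b, s + t) \<in> U"
    by (rule approx_by_center[OF assms])
  then show ?thesis
    using that[of b "s + t"] scott_open_onD(1)[OF U] x by auto
qed

text \<open>Primeness of \<open>V\<close> makes its complement an irreducible closed set, whose
  generic point is sought. The basic balls \<open>q\<close> for which \<open>way_above q\<close>
  meets the complement form a directed family, because two such open sets then meet it jointly; the
  supremum of this family is the generic point.\<close>

lemma ball_space_sober:
  assumes V: "ball_open V" "V \<noteq> formal_balls X"
    and prime: "\<And>U W. ball_open U \<Longrightarrow> ball_open W \<Longrightarrow> U \<inter> W \<subseteq> V \<Longrightarrow> U \<subseteq> V \<or> W \<subseteq> V"
  obtains p where "p \<in> formal_balls X" "p \<notin> V" "\<And>q. q \<in> formal_balls X \<Longrightarrow> q \<notin> V \<Longrightarrow> ball_le d q p"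
proof -
  define D where "D = {p \<in> formal_balls B. \<not> way_above p \<subseteq> V}"
  have DX: "D \<subseteq> formal_balls X" using B_subset by (auto simp: D_def)
  have open_way: "ball_open (way_above p)" if "p \<in> D" for p
    using that center by (cases p) (auto simp: D_def intro: ball_open_way_above)
  have ex: "\<exists>p\<in>D. p \<in> U" if U: "ball_open U" and "\<not> U \<subseteq> V" for U
  proof -
    obtain x s where x: "(x, s) \<in> U" "(x, s) \<notin> V" using \<open>\<not> U \<subseteq> V\<close> by auto
    obtain b \<epsilon> where b: "b \<in> B" "\<epsilon> < s + 1" "(x, s) \<in> way_above (b, \<epsilon>)" "(b, \<epsilon>) \<in> U"
      by (rule interpolate_way_above[OF U x(1) zero_less_one])
    have "\<not> way_above (b, \<epsilon>) \<subseteq> V" using b(3) x(2) by (meson subsetD)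
    moreover have "(b, \<epsilon>) \<in> formal_balls X" using scott_open_onD(1)[OF U] b(4) by (rule subsetD)
    ultimately have "(b, \<epsilon>) \<in> D" using b(1) by (simp add: D_def)
    then show ?thesis using b(4) by (rule bexI[rotated])
  qed
  have dir: "directed_on (ball_le d) D"
    unfolding directed_on_def
  proof (intro conjI ballI)
    have "\<not> formal_balls X \<subseteq> V" using V scott_open_onD(1)[OF V(1)] by auto
    then show "D \<noteq> {}" using ex[OF ball_open_all] by auto
  next
    fix p q assume "p \<in> D" "q \<in> D"
    then have "\<not> way_above p \<inter> way_above q \<subseteq> V"
      using prime[OF open_way open_way, of p q] by (auto simp: D_def)
    then obtain u where "u \<in> D" "u \<in> way_above p \<inter> way_above q"
      using ex ball_open_Int[OF open_way open_way] \<open>p \<in> D\<close> \<open>q \<in> D\<close> by blast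
    then show "\<exists>u\<in>D. ball_le d p u \<and> ball_le d q u"
      using way_above_le by blast
  qed
  obtain p where p: "ball_sup D p" using ball_sup_exists[OF DX dir] .
  have pX: "p \<in> formal_balls X" by (rule is_sup_on_mem[OF p])
  show ?thesis
  proof (rule that[OF pX])
    show "p \<notin> V"
    proof
      assume "p \<in> V"
      then obtain q where "q \<in> D" "q \<in> V" using scott_open_onD(3)[OF V(1) DX dir p] by blast
      then show False using way_above_subset[OF V(1)] by (auto simp: D_def)
    qed
    show "ball_le d q p" if q: "q \<in> formal_balls X" "q \<notin> V" for q
    proof (rule ccontr)
      assume "\<not> ball_le d q p"
      then obtain u where "u \<in> D" "\<not> ball_le d u p"
        using ex[OF ball_open_not_below[OF pX]] q by blast
      then show False using is_sup_on_upper[OF p] by blast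
    qed
  qed
qed

text \<open>The assumption \<open>fin\<close> is Scott-openness of the filter, phrased with finite
  subfamilies. If \<open>U \<notin> \<G>\<close>, take \<open>V \<supseteq> U\<close> maximal among
  the open sets outside \<open>\<G>\<close>; closure of \<open>\<G>\<close> under intersection makes
  \<open>V\<close> prime, so the complement of \<open>V\<close> has a greatest ball
  \<open>p\<close>. A member of \<open>\<G>\<close> missing \<open>p\<close> would be contained in
  \<open>V\<close>, hence \<open>p \<in> \<Inter>\<G> \<subseteq> U \<subseteq> V\<close>, a
  contradiction.\<close>

lemma hofmann_mislove:
  assumes G: "\<And>U. U \<in> \<G> \<Longrightarrow> ball_open U" "\<G> \<noteq> {}"
    and up: "\<And>U V. U \<in> \<G> \<Longrightarrow> ball_open V \<Longrightarrow> U \<subseteq> V \<Longrightarrow> V \<in> \<G>"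
    and inter: "\<And>U V. U \<in> \<G> \<Longrightarrow> V \<in> \<G> \<Longrightarrow> U \<inter> V \<in> \<G>"
    and fin: "\<And>\<K>. (\<And>K. K \<in> \<K> \<Longrightarrow> ball_open K) \<Longrightarrow> \<Union>\<K> \<in> \<G> \<Longrightarrow> \<exists>\<F>. finite \<F> \<and> \<F> \<subseteq> \<K> \<and> \<Union>\<F> \<in> \<G>"
    and U: "ball_open U" "\<Inter>\<G> \<subseteq> U"
  shows "U \<in> \<G>"
proof (rule ccontr)
  assume "U \<notin> \<G>"
  define \<A> where "\<A> = {V. ball_open V \<and> U \<subseteq> V \<and> V \<notin> \<G>}"
  have "\<exists>M\<in>\<A>. \<forall>V\<in>\<A>. M \<subseteq> V \<longrightarrow> V = M"
  proof (rule subset_Zorn_nonempty)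
    show "\<A> \<noteq> {}" using U \<open>U \<notin> \<G>\<close> by (auto simp: \<A>_def)
    fix \<C> assume \<C>: "\<C> \<noteq> {}" "subset.chain \<A> \<C>"
    have \<C>\<A>: "\<C> \<subseteq> \<A>" using \<C>(2) by (simp add: subset.chain_def)
    have "\<Union>\<C> \<notin> \<G>"
    proof
      assume "\<Union>\<C> \<in> \<G>"
      then obtain \<F> where \<F>: "finite \<F>" "\<F> \<subseteq> \<C>" "\<Union>\<F> \<in> \<G>"
        using fin[of \<C>] \<C>\<A> by (auto simp: \<A>_def)
      from \<F>(1,2) have "\<exists>K\<in>\<C>. \<Union>\<F> \<subseteq> K"
      proof (induction \<F> rule: finite_induct)
        case empty
        then show ?case using \<C>(1) by auto
      next
        case (insert V \<F>)
        then obtain K where K: "K \<in> \<C>" "\<Union>\<F> \<subseteq> K" by auto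
        moreover have "V \<subseteq> K \<or> K \<subseteq> V"
          using \<C>(2) K(1) insert.prems unfolding subset.chain_def by blast
        ultimately show ?case
        proof (elim disjE)
          assume "V \<subseteq> K"
          then show ?case using K by (intro bexI[of _ K]) auto
        next
          assume "K \<subseteq> V"
          then show ?case using K insert.prems by (intro bexI[of _ V]) auto
        qed
      qed
      then obtain K where K: "K \<in> \<C>" "\<Union>\<F> \<subseteq> K" by (elim bexE)
      have "K \<in> \<A>" using \<C>\<A> K(1) by (rule subsetD)
      then have "ball_open K" "K \<notin> \<G>" by (simp_all add: \<A>_def)
      then show False using up[OF \<F>(3) _ K(2)] by simp
    qed
    moreover have "ball_open (\<Union>\<C>)" using \<C>\<A> by (intro ball_open_Union) (auto simp: \<A>_def)
    moreover have "U \<subseteq> \<Union>\<C>"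
    proof -
      obtain K where K: "K \<in> \<C>" using \<C>(1) by blast
      have "K \<in> \<A>" using \<C>\<A> K by (rule subsetD)
      then have "U \<subseteq> K" by (simp add: \<A>_def)
      then show ?thesis using K by (meson Union_upper order_trans)
    qed
    ultimately show "\<Union>\<C> \<in> \<A>" by (simp add: \<A>_def)
  qed
  then obtain V where "V \<in> \<A>" and max': "\<forall>W\<in>\<A>. V \<subseteq> W \<longrightarrow> W = V"
    by (elim bexE)
  then have V: "ball_open V" "U \<subseteq> V" "V \<notin> \<G>" by (simp_all add: \<A>_def)
  have max: "W = V" if "ball_open W" "V \<subseteq> W" "W \<notin> \<G>" for W
  proof -
    have "U \<subseteq> W" using V(2) that(2) by (rule order_trans)
    then have "W \<in> \<A>" using that by (simp add: \<A>_def)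
    then show ?thesis using max' that(2) by simp
  qed
  obtain W where "W \<in> \<G>" using G(2) by auto
  then have "formal_balls X \<in> \<G>"
    by (rule up[OF _ ball_open_all]) (rule scott_open_onD(1)[OF G(1)[OF \<open>W \<in> \<G>\<close>]])
  then have "V \<noteq> formal_balls X" using V by auto
  moreover have "U1 \<subseteq> V \<or> U2 \<subseteq> V" if o: "ball_open U1" "ball_open U2" and sub: "U1 \<inter> U2 \<subseteq> V" for U1 U2
  proof (rule ccontr)
    assume "\<not> ?thesis"
    then have "V \<union> U1 \<in> \<G>" "V \<union> U2 \<in> \<G>"
      using max[OF ball_open_Un[OF V(1) o(1)]] max[OF ball_open_Un[OF V(1) o(2)]] by blast+
    then have "(V \<union> U1) \<inter> (V \<union> U2) \<in> \<G>" by (rule inter)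
    then show False using up[OF _ V(1)] V(3) sub by blast
  qed
  ultimately obtain p where p: "p \<in> formal_balls X" "p \<notin> V"
    "\<And>q. q \<in> formal_balls X \<Longrightarrow> q \<notin> V \<Longrightarrow> ball_le d q p"
    using ball_space_sober[OF V(1)] by metis
  have "p \<in> W" if "W \<in> \<G>" for W
  proof (rule ccontr)
    assume "p \<notin> W"
    then have "W \<subseteq> V"
      using p ball_openD[OF G(1)[OF that]] scott_open_onD(1)[OF G(1)[OF that]] by blast
    then show False using up[OF that V(1)] V(3) by simp
  qed
  then show False using U(2) V(2) p(2) by blast
qed

end

section \<open>Suprema of directed families of quasi-lenses\<close>

locale lens_family = algebraic_space +
  fixes D :: "(('a set \<times> 'a set) \<times> real) set"
  assumes D_sub: "D \<subseteq> lens_balls" and D_directed: "directed_on lens_le D"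
begin

definition "rad = Inf (snd ` D)"

definition "ev_box U \<longleftrightarrow> (\<exists>\<beta>\<in>D. fb_box \<beta> U)"

definition "ev_dia U \<longleftrightarrow> (\<exists>\<beta>\<in>D. fb_dia \<beta> U)"

definition "lim_Q = {x \<in> X. \<forall>U. ball_open U \<longrightarrow> ev_box U \<longrightarrow> (x, rad) \<in> U}"

definition "lim_C = {x \<in> X. \<forall>U. ball_open U \<longrightarrow> (x, rad) \<in> U \<longrightarrow> ev_dia U}"

lemma member:
  assumes "((Q, C), r) \<in> D"
  shows "(Q, C) \<in> quasi_lenses X d" "0 \<le> r" "Q \<subseteq> X" "C \<subseteq> X"
proof -
  show "(Q, C) \<in> quasi_lenses X d" "0 \<le> r" using subsetD[OF D_sub assms] by simp_all
  then show "Q \<subseteq> X" "C \<subseteq> X" by (simp_all add: quasi_lensD)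
qed

lemma D_nonempty: "D \<noteq> {}"
  using D_directed by (simp add: directed_on_def)

lemma radii_bdd_below: "bdd_below (snd ` D)"
  using member(2) by (intro bdd_belowI[of _ 0]) auto

lemma rad_le: "((Q, C), r) \<in> D \<Longrightarrow> rad \<le> r"
  unfolding rad_def using radii_bdd_below by (intro cINF_lower2[of _ _ "((Q, C), r)"]) auto

lemma rad_nonneg: "0 \<le> rad"
  unfolding rad_def using member(2) D_nonempty by (intro cINF_greatest) auto

lemma rad_approx:
  assumes "0 < e"
  obtains Q C r where "((Q, C), r) \<in> D" "r < rad + e"
proof -
  have "Inf (snd ` D) < rad + e" using assms by (simp add: rad_def)
  then obtain \<beta> where "\<beta> \<in> D" "snd \<beta> < rad + e"
    using D_nonempty radii_bdd_below by (auto simp: cInf_less_iff)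
  then show ?thesis using that by (metis surj_pair snd_conv)
qed

lemma box_mono: "\<beta> \<in> D \<Longrightarrow> \<gamma> \<in> D \<Longrightarrow> lens_le \<beta> \<gamma> \<Longrightarrow> ball_open U \<Longrightarrow> fb_box \<beta> U \<Longrightarrow> fb_box \<gamma> U"
  and dia_mono: "\<beta> \<in> D \<Longrightarrow> \<gamma> \<in> D \<Longrightarrow> lens_le \<beta> \<gamma> \<Longrightarrow> ball_open U \<Longrightarrow> fb_dia \<beta> U \<Longrightarrow> fb_dia \<gamma> U"
  using lens_le_iff[of \<beta> \<gamma>] D_sub by blast+

lemma upper_bound:
  assumes "\<beta> \<in> D" "\<gamma> \<in> D"
  obtains \<alpha> where "\<alpha> \<in> D" "lens_le \<beta> \<alpha>" "lens_le \<gamma> \<alpha>"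
  using D_directed assms unfolding directed_on_def by blast

lemma ev_boxI: "((Q, C), r) \<in> D \<Longrightarrow> (\<And>x. x \<in> Q \<Longrightarrow> (x, r) \<in> U) \<Longrightarrow> ev_box U"
  unfolding ev_box_def by (intro bexI[of _ "((Q, C), r)"]) simp_all

lemma ev_diaI: "((Q, C), r) \<in> D \<Longrightarrow> x \<in> C \<Longrightarrow> (x, r) \<in> U \<Longrightarrow> ev_dia U"
  unfolding ev_dia_def by (intro bexI[of _ "((Q, C), r)"]) auto

lemma ev_boxE:
  assumes "ev_box U"
  obtains Q C r where "((Q, C), r) \<in> D" "\<forall>x\<in>Q. (x, r) \<in> U"
  using assms unfolding ev_box_def by (metis fb_box_iff surj_pair)

lemma ev_dia_mono: "ev_dia U \<Longrightarrow> U \<subseteq> V \<Longrightarrow> ev_dia V"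
  unfolding ev_dia_def using fb_dia_mono by blast

lemma ev_box_mono: "ev_box U \<Longrightarrow> U \<subseteq> V \<Longrightarrow> ev_box V"
  unfolding ev_box_def using fb_box_mono by blast

lemma ev_box_Int:
  assumes o: "ball_open U" "ball_open V" and "ev_box U" "ev_box V"
  shows "ev_box (U \<inter> V)"
proof -
  obtain \<beta> \<gamma> where "\<beta> \<in> D" "fb_box \<beta> U" "\<gamma> \<in> D" "fb_box \<gamma> V"
    using assms unfolding ev_box_def by blast
  then obtain \<alpha> where "\<alpha> \<in> D" "fb_box \<alpha> U" "fb_box \<alpha> V"
    using upper_bound[of \<beta> \<gamma>] box_mono o by metis
  then have "fb_box \<alpha> (U \<inter> V)" by (cases \<alpha>) auto
  then show ?thesis using \<open>\<alpha> \<in> D\<close> unfolding ev_box_def by blast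
qed

text \<open>Directedness supplies a single member passing both tests, so that conditions linking
  \<open>Q\<close> and \<open>C\<close> can be applied inside it.\<close>

lemma ev_box_dia:
  assumes o: "ball_open U" "ball_open V" and "ev_box U" "ev_dia V"
  obtains Q C r where "((Q, C), r) \<in> D" "fb_box ((Q, C), r) U" "fb_dia ((Q, C), r) V"
proof -
  obtain \<beta> \<gamma> where "\<beta> \<in> D" "fb_box \<beta> U" "\<gamma> \<in> D" "fb_dia \<gamma> V"
    using assms unfolding ev_box_def ev_dia_def by blast
  then obtain \<alpha> where "\<alpha> \<in> D" "fb_box \<alpha> U" "fb_dia \<alpha> V"
    using upper_bound[of \<beta> \<gamma>] box_mono dia_mono o by metis
  then show ?thesis using that by (metis surj_pair)
qed

lemma ev_box_radius: "0 < e \<Longrightarrow> ev_box {(x, s). (x, s) \<in> formal_balls X \<and> s < rad + e}"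
  using rad_approx[of e] ev_boxI member by (smt (verit) case_prodI mem_Collect_eq mem_formal_balls subsetD)

text \<open>Scott-openness of the filter \<open>ev_box\<close>: the member passing the test has a
  compact first component.\<close>

lemma ev_box_finite:
  assumes o: "\<And>i. i \<in> I \<Longrightarrow> ball_open (K i)" and "ev_box (\<Union>i\<in>I. K i)"
  obtains J where "finite J" "J \<subseteq> I" "ev_box (\<Union>i\<in>J. K i)"
proof -
  obtain Q C r where Q: "((Q, C), r) \<in> D" "\<forall>x\<in>Q. (x, r) \<in> (\<Union>i\<in>I. K i)"
    by (rule ev_boxE[OF assms(2)])
  have "\<exists>i\<in>I. (x, r) \<in> K i" if "x \<in> Q" for x using bspec[OF Q(2) that] by simp
  then show ?thesis
  proof (rule compact_cover[OF quasi_lensD(1)[OF member(1)[OF Q(1)]] member(2)[OF Q(1)] o, rotated])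
    fix J assume J: "finite J" "J \<subseteq> I" "\<And>x. x \<in> Q \<Longrightarrow> \<exists>i\<in>J. (x, r) \<in> K i"
    have "ev_box (\<Union>i\<in>J. K i)" using J(3) by (intro ev_boxI[OF Q(1)]) auto
    then show ?thesis using that J by blast
  qed
qed

lemma ev_box_of_lim:
  assumes U: "ball_open U" and sub: "\<And>x. x \<in> lim_Q \<Longrightarrow> (x, rad) \<in> U"
  shows "ev_box U"
proof -
  \<comment> \<open>Balls in \<open>\<Inter>?G\<close> have radius at most \<open>rad\<close>,
    possibly less, while \<open>lim_Q\<close> only controls radius exactly \<open>rad\<close>.
    Adding \<open>?R\<close> to \<open>U\<close> disposes of the smaller ones, and is harmless
    because all members of \<open>D\<close> have radius at least \<open>rad\<close>.\<close>
  let ?R = "{(x, s). (x, s) \<in> formal_balls X \<and> s < rad}"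
  let ?G = "{V. ball_open V \<and> ev_box V}"
  have radE: "s < rad + e" if "\<forall>V\<in>?G. (x, s) \<in> V" "0 < e" for x s e
  proof -
    have "{(x, s). (x, s) \<in> formal_balls X \<and> s < rad + e} \<in> ?G"
      using ev_box_radius[OF that(2)] ball_open_radius by simp
    from bspec[OF that(1) this] show ?thesis by simp
  qed
  have all: "formal_balls X \<in> ?G"
  proof -
    have "ev_box (formal_balls X)" by (rule ev_box_mono[OF ev_box_radius[OF zero_less_one]]) auto
    then show ?thesis using ball_open_all by simp
  qed
  have "U \<union> ?R \<in> ?G"
  proof (rule hofmann_mislove)
    show "?G \<noteq> {}" using all by blast
    show "ball_open (U \<union> ?R)" by (intro ball_open_Un U ball_open_radius)
    show "\<Inter>?G \<subseteq> U \<union> ?R"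
    proof
      fix p assume p: "p \<in> \<Inter>?G"
      obtain x s where eq: "p = (x, s)" by fastforce
      have pV: "\<forall>V\<in>?G. (x, s) \<in> V" using p eq by blast
      have xs: "x \<in> X" "0 \<le> s" using bspec[OF pV all] by simp_all
      have "s \<le> rad"
        by (rule field_le_epsilon, rule less_imp_le, rule radE[OF pV])
      show "p \<in> U \<union> ?R"
      proof (cases "s < rad")
        case True
        then show ?thesis using xs eq by simp
      next
        case False
        then have s: "s = rad" using \<open>s \<le> rad\<close> by simp
        then have "x \<in> lim_Q" using pV xs unfolding lim_Q_def by blast
        then show ?thesis using sub eq s by simp
      qed
    qed
    show "\<exists>\<F>. finite \<F> \<and> \<F> \<subseteq> \<K> \<and> \<Union>\<F> \<in> ?G"
      if o: "\<And>K. K \<in> \<K> \<Longrightarrow> ball_open K" and "\<Union>\<K> \<in> ?G" for \<K>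
    proof -
      have e: "ev_box (\<Union>i\<in>\<K>. i)" using that(2) by simp
      obtain J where J: "finite J" "J \<subseteq> \<K>" "ev_box (\<Union>i\<in>J. i)"
        by (rule ev_box_finite[of \<K> "\<lambda>K. K", OF o e])
      moreover have "ball_open (\<Union>J)" using J(2) o by (intro ball_open_Union) auto
      ultimately show ?thesis by auto
    qed
  qed (auto intro: ev_box_mono ball_open_Int ev_box_Int)
  then have "ev_box (U \<union> ?R)" by simp
  then obtain Q C r where Q: "((Q, C), r) \<in> D" "\<forall>x\<in>Q. (x, r) \<in> U \<union> ?R"
    using ev_boxE by blast
  then show ?thesis using rad_le[OF Q(1)] by (intro ev_boxI[OF Q(1)]) force
qed

lemma ev_box_iff:
  "ball_open U \<Longrightarrow> ev_box U \<longleftrightarrow> (\<forall>x\<in>lim_Q. (x, rad) \<in> U)"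
  using ev_box_of_lim by (auto simp: lim_Q_def)

lemma ev_dia_step:
  assumes U: "ball_open U" "ev_dia U" and e: "0 < e"
  obtains q where "q \<in> formal_balls B" "q \<in> U" "ev_dia (way_above q)" "snd q < rad + e"
proof -
  \<comment> \<open>One half bounds the excess of a member's radius over \<open>rad\<close>, the
    other half the excess of the new ball's radius over that of the member.\<close>
  have "0 < e / 2" using e by simp
  obtain Q C r where "((Q, C), r) \<in> D"
    "fb_box ((Q, C), r) {(x, s). (x, s) \<in> formal_balls X \<and> s < rad + e / 2}" "fb_dia ((Q, C), r) U"
    using ev_box_dia[OF ball_open_radius U(1) ev_box_radius[OF \<open>0 < e / 2\<close>] U(2)] .
  then have D: "((Q, C), r) \<in> D" and "r < rad + e / 2" and dia: "fb_dia ((Q, C), r) U"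
    using quasi_lensD(4)[OF member(1)] by fastforce+
  obtain y where y: "y \<in> C" "(y, r) \<in> U" using dia by auto
  obtain b \<epsilon> where b: "b \<in> B" "\<epsilon> < r + e / 2" "(y, r) \<in> way_above (b, \<epsilon>)" "(b, \<epsilon>) \<in> U"
    by (rule interpolate_way_above[OF U(1) y(2) \<open>0 < e / 2\<close>])
  have "0 \<le> \<epsilon>" using subsetD[OF scott_open_onD(1)[OF U(1)] b(4)] by simp
  moreover have "ev_dia (way_above (b, \<epsilon>))" by (rule ev_diaI[OF D y(1) b(3)])
  ultimately show ?thesis
    using b \<open>r < rad + e / 2\<close> by (intro that[of "(b, \<epsilon>)"]) auto
qed

lemma lim_of_ev_dia:
  assumes U: "ball_open U" "ev_dia U"
  obtains x where "x \<in> lim_C" "(x, rad) \<in> U"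
proof -
  \<comment> \<open>The condition \<open>ev_dia (way_above q)\<close> does three things: it lets the
    next ball be chosen inside \<open>way_above q\<close>, it forces \<open>snd q\<close> to exceed
    the radius of a member and so to be at least \<open>rad\<close>, and it passes to every open set
    containing \<open>q\<close>, which puts the limit point into \<open>lim_C\<close>.\<close>
  define P where "P n q \<longleftrightarrow> q \<in> formal_balls B \<and> q \<in> U \<and> ev_dia (way_above q) \<and> snd q < rad + 1 / Suc n" for n q
  have BX: "q \<in> formal_balls X" if "q \<in> formal_balls B" for q
    using that B_subset by (cases q) auto
  have way_open: "ball_open (way_above q)" if "q \<in> formal_balls B" for q
    using that center by (cases q) (auto intro: ball_open_way_above)
  have "\<exists>f. \<forall>n. P n (f n) \<and> ball_le d (f n) (f (Suc n))"
  proof (rule dependent_nat_choice)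
    show "\<exists>q. P 0 q" using ev_dia_step[OF U, of 1] unfolding P_def by (metis div_by_1 of_nat_1 One_nat_def zero_less_one)
  next
    fix p n assume p: "P n p"
    have "ball_open (way_above p)" "ev_dia (way_above p)" "0 < 1 / real (Suc (Suc n))"
      using p way_open by (simp_all add: P_def)
    then obtain q where q: "q \<in> formal_balls B" "q \<in> way_above p" "ev_dia (way_above q)"
      "snd q < rad + 1 / Suc (Suc n)"
      by (rule ev_dia_step)
    have "ball_le d p q" by (rule way_above_le[OF q(2)])
    moreover have "q \<in> U" using p q by (intro ball_openD[OF U(1) _ BX \<open>ball_le d p q\<close>]) (auto simp: P_def)
    ultimately show "\<exists>q. P (Suc n) q \<and> ball_le d p q" using q unfolding P_def by blast
  qed
  then obtain f where f: "\<And>n. P n (f n)" "\<And>n. ball_le d (f n) (f (Suc n))" by blast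
  have fX: "f n \<in> formal_balls X" for n using f(1) BX by (simp add: P_def)
  have mono: "ball_le d (f m) (f n)" if "m \<le> n" for m n
    using that
  proof (induction n rule: dec_induct)
    case base
    show ?case by (rule ball_le_refl[OF quasi_metric fX])
  next
    case (step n)
    then show ?case using ball_le_trans[OF quasi_metric fX fX fX] f(2) by blast
  qed
  have dir: "directed_on (ball_le d) (range f)"
    unfolding directed_on_def using mono max.cobounded1 max.cobounded2 by blast
  have sub: "range f \<subseteq> formal_balls X" using fX by auto
  obtain x s where sup: "ball_sup (range f) (x, s)"
    using ball_sup_exists[OF sub dir] by (metis surj_pair)
  have xs: "x \<in> X" "0 \<le> s" using is_sup_on_mem[OF sup] by simp_all
  have le_sup: "ball_le d (f n) (x, s)" for n using is_sup_on_upper[OF sup] by blast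
  have gt: "rad \<le> snd (f n)" for n
  proof -
    obtain \<beta> where \<beta>: "\<beta> \<in> D" "fb_dia \<beta> (way_above (f n))"
      using f(1)[of n] unfolding P_def ev_dia_def by blast
    obtain Q C r where eq: "\<beta> = ((Q, C), r)" by (metis surj_pair)
    then obtain y where "(y, r) \<in> way_above (fst (f n), snd (f n))" using \<beta> by auto
    then have "r < snd (f n)" by (rule way_above_radius)
    then show ?thesis using rad_le[of Q C r] \<beta> eq by simp
  qed
  have "s \<le> rad"
  proof (rule field_le_epsilon)
    fix e :: real assume "0 < e"
    then obtain n where "1 / Suc n < e" using nat_approx_posE by blast
    moreover have "s \<le> snd (f n)" using le_sup[of n] by (cases "f n") simp
    moreover have "snd (f n) < rad + 1 / Suc n" using f(1) by (simp add: P_def)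
    ultimately show "s \<le> rad + e" by linarith
  qed
  moreover have "rad \<le> s"
  proof (rule field_le_epsilon)
    fix e :: real assume "0 < e"
    then have "\<exists>(y, t)\<in>range f. t < s + e" by (rule ball_sup_radius[OF sub dir sup])
    then obtain n where "snd (f n) < s + e" by (auto simp: case_prod_beta)
    then show "rad \<le> s + e" using gt[of n] by linarith
  qed
  ultimately have s: "s = rad" by simp
  show ?thesis
  proof (rule that)
    show "(x, rad) \<in> U"
    proof (rule ball_openD[OF U(1)])
      show "f 0 \<in> U" using f(1)[of 0] by (simp add: P_def)
      show "ball_le d (f 0) (x, rad)" using le_sup[of 0] s by simp
    qed (use xs s in simp)
    have "ev_dia V" if V: "ball_open V" "(x, rad) \<in> V" for V
    proof -
      have "(x, s) \<in> V" using V s by simp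
      then obtain q where "q \<in> range f" "q \<in> V"
        using scott_open_onD(3)[OF V(1) sub dir sup] by blast
      then obtain n where "f n \<in> V" by auto
      have "ev_dia (way_above (f n))" using f(1)[of n] by (simp add: P_def)
      then show ?thesis using way_above_subset[OF V(1) \<open>f n \<in> V\<close>] by (rule ev_dia_mono)
    qed
    then show "x \<in> lim_C" using xs by (simp add: lim_C_def)
  qed
qed

lemma ev_dia_iff:
  assumes "ball_open U"
  shows "ev_dia U \<longleftrightarrow> (\<exists>x\<in>lim_C. (x, rad) \<in> U)"
proof
  assume "ev_dia U"
  then obtain x where "x \<in> lim_C" "(x, rad) \<in> U" by (rule lim_of_ev_dia[OF assms])
  then show "\<exists>x\<in>lim_C. (x, rad) \<in> U" by blast
next
  assume "\<exists>x\<in>lim_C. (x, rad) \<in> U"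
  then show "ev_dia U" using assms by (auto simp: lim_C_def)
qed

section \<open>Quasi-lens conditions for the limit pair\<close>

lemma lim_Q_subset: "lim_Q \<subseteq> X" and lim_C_subset: "lim_C \<subseteq> X"
  by (auto simp: lim_Q_def lim_C_def)

lemma compact_lim_Q: "compactin T lim_Q"
  unfolding compactin_def
proof (intro conjI allI impI)
  show "lim_Q \<subseteq> topspace T" using lim_Q_subset by simp
  fix \<U> assume \<U>: "(\<forall>U\<in>\<U>. openin T U) \<and> lim_Q \<subseteq> \<Union>\<U>"
  have "\<forall>U\<in>\<U>. \<exists>W. ball_open W \<and> U = {x \<in> X. (x, rad) \<in> W}"
    using \<U> openin_T_iff[OF rad_nonneg] by blast
  then obtain W where W: "\<And>U. U \<in> \<U> \<Longrightarrow> ball_open (W U)" "\<And>U. U \<in> \<U> \<Longrightarrow> U = {x \<in> X. (x, rad) \<in> W U}"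
    by metis
  have "ball_open (\<Union>U\<in>\<U>. W U)" using W(1) by (intro ball_open_Union) auto
  moreover have "(x, rad) \<in> (\<Union>U\<in>\<U>. W U)" if x: "x \<in> lim_Q" for x
  proof -
    obtain U where U: "U \<in> \<U>" "x \<in> U" using \<U> x by auto
    then have "(x, rad) \<in> W U" using W(2) by blast
    then show ?thesis using U by blast
  qed
  ultimately have "ev_box (\<Union>U\<in>\<U>. W U)" by (rule ev_box_of_lim)
  then obtain J where J: "finite J" "J \<subseteq> \<U>" "ev_box (\<Union>U\<in>J. W U)"
    using ev_box_finite[of \<U> W] W(1) by blast
  have o: "ball_open (\<Union>U\<in>J. W U)" using W(1) J(2) by (intro ball_open_Union) auto
  have "lim_Q \<subseteq> \<Union>J"
  proof
    fix x assume x: "x \<in> lim_Q"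
    then obtain U where U: "U \<in> J" "(x, rad) \<in> W U" using ev_box_iff[OF o] J(3) by auto
    have "x \<in> X" using x lim_Q_subset by auto
    then have "x \<in> U" using W(2)[of U] U J(2) by blast
    then show "x \<in> \<Union>J" using U by blast
  qed
  then show "\<exists>\<F>. finite \<F> \<and> \<F> \<subseteq> \<U> \<and> lim_Q \<subseteq> \<Union>\<F>" using J by blast
qed

lemma closed_lim_C: "closedin T lim_C"
proof -
  have "openin T {x \<in> X. (x, rad) \<in> \<Union>{U. ball_open U \<and> \<not> ev_dia U}}"
    by (intro openin_T_trace ball_open_Union rad_nonneg) auto
  moreover have "{x \<in> X. (x, rad) \<in> \<Union>{U. ball_open U \<and> \<not> ev_dia U}} = X - lim_C"
    by (auto simp: lim_C_def)
  ultimately show ?thesis using lim_C_subset by (simp add: closedin_def)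
qed

lemma lim_Q_up: "up_closure X d lim_Q = lim_Q"
proof
  show "lim_Q \<subseteq> up_closure X d lim_Q"
    using quasi_metricD(1)[OF quasi_metric] lim_Q_subset by (auto simp: up_closure_def)
  show "up_closure X d lim_Q \<subseteq> lim_Q"
  proof
    fix y assume "y \<in> up_closure X d lim_Q"
    then obtain x where x: "y \<in> X" "x \<in> lim_Q" "d x y = 0" by (auto simp: up_closure_def)
    have "(y, rad) \<in> U" if "ball_open U" "ev_box U" for U
    proof (rule ball_openD[OF that(1)])
      show "(x, rad) \<in> U" using x(2) that by (simp add: lim_Q_def)
    qed (use x rad_nonneg in simp_all)
    then show "y \<in> lim_Q" using x(1) by (simp add: lim_Q_def)
  qed
qed

text \<open>The closed set \<open>lim_C \<inter> \<down>x\<close> misses \<open>lim_Q\<close> only if some \<open>Q \<times> {r}\<close> of the family lies in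
  the complement of the principal ideal of \<open>(x, rad)\<close>.\<close>

lemma lim_Q_minimal: "lim_Q \<subseteq> up_closure X d (lim_Q \<inter> lim_C)"
proof (rule subsetI, rule ccontr)
  fix x assume x: "x \<in> lim_Q" and "x \<notin> up_closure X d (lim_Q \<inter> lim_C)"
  have xX: "x \<in> X" using x lim_Q_subset by auto
  then have no: "d z x \<noteq> 0" if "z \<in> lim_Q" "z \<in> lim_C" for z
    using that \<open>x \<notin> up_closure X d (lim_Q \<inter> lim_C)\<close> by (auto simp: up_closure_def)
  let ?W = "\<Union>{U. ball_open U \<and> \<not> ev_dia U}"
  let ?N = "{q \<in> formal_balls X. \<not> ball_le d q (x, rad)}"
  have xr: "(x, rad) \<in> formal_balls X" using xX rad_nonneg by simp
  have oW: "ball_open ?W" by (intro ball_open_Union) auto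
  have oN: "ball_open ?N" by (rule ball_open_not_below[OF xr])
  have "(z, rad) \<in> ?W \<union> ?N" if z: "z \<in> lim_Q" for z
  proof (cases "z \<in> lim_C")
    case True
    then show ?thesis using no[OF z] z lim_Q_subset rad_nonneg by auto
  next
    case False
    then show ?thesis using z lim_Q_subset by (auto simp: lim_C_def)
  qed
  then have "ev_box (?W \<union> ?N)"
    using ball_open_Un[OF oW oN] by (rule ev_box_of_lim[rotated])
  then obtain Q C r where D: "((Q, C), r) \<in> D" and sub: "\<forall>y\<in>Q. (y, r) \<in> ?W \<union> ?N"
    using ev_boxE by blast
  note m = member[OF D]
  \<comment> \<open>By the lens condition \<open>y\<close> lies above some
    \<open>z \<in> Q \<inter> C\<close>, and \<open>(z, r)\<close> cannot be in \<open>?W\<close>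
    because this very member would then witness \<open>ev_dia\<close>. So \<open>(z, r)\<close>, and
    with it \<open>(y, r)\<close>, is in \<open>?N\<close>.\<close>
  have "(y, r) \<in> ?N" if y: "y \<in> Q" for y
  proof -
    obtain z where z: "z \<in> Q" "z \<in> C" "d z y = 0"
      using quasi_lensD(5)[OF m(1)] y by (auto simp: up_closure_def)
    have "(z, r) \<notin> ?W"
    proof
      assume "(z, r) \<in> ?W"
      then obtain U where "ball_open U" "\<not> ev_dia U" "(z, r) \<in> U" by blast
      then show False using ev_diaI[OF D z(2)] by blast
    qed
    then have "(z, r) \<in> ?N" using bspec[OF sub z(1)] by blast
    then show ?thesis
      by (rule ball_openD[OF oN]) (use y z m in auto)
  qed
  then have "ev_box ?N" by (rule ev_boxI[OF D])
  then have "(x, rad) \<in> ?N" using x oN unfolding lim_Q_def by blast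
  then show False using ball_le_refl[OF quasi_metric xr] by blast
qed

lemma lim_Q_nonempty: "lim_Q \<noteq> {}"
proof
  assume "lim_Q = {}"
  then have "ev_box {}" by (intro ev_box_of_lim ball_open_empty) simp
  then obtain Q C r where D: "((Q, C), r) \<in> D" "\<forall>y\<in>Q. (y, r) \<in> {}"
    using ev_boxE by blast
  then show False using quasi_lensD(4)[OF member(1)[OF D(1)]] by auto
qed

text \<open>In a member passing the box test \<open>W\<close> and the diamond test \<open>Z\<close>,
  density gives a point of \<open>C\<close> in both traces; so \<open>W \<inter> Z\<close> passes a
  diamond test, which the limit inherits.\<close>

lemma lim_C_density:
  assumes U: "openin T U" "lim_Q \<subseteq> U"
  shows "lim_C \<subseteq> T closure_of (U \<inter> lim_C)"
proof
  fix x assume x: "x \<in> lim_C"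
  obtain W where W: "ball_open W" "U = {x \<in> X. (x, rad) \<in> W}"
    using U(1) openin_T_iff[OF rad_nonneg] by blast
  have evW: "ev_box W" using U(2) W(2) by (intro ev_box_of_lim W(1)) auto
  show "x \<in> T closure_of (U \<inter> lim_C)"
    unfolding in_closure_of
  proof (intro conjI allI impI)
    show "x \<in> topspace T" using x lim_C_subset by auto
    fix V assume V: "x \<in> V \<and> openin T V"
    then obtain Z where Z: "ball_open Z" "V = {x \<in> X. (x, rad) \<in> Z}"
      using openin_T_iff[OF rad_nonneg] by blast
    then have evZ: "ev_dia Z" using V x ev_dia_iff by blast
    obtain Q C r where D: "((Q, C), r) \<in> D" and Q: "fb_box ((Q, C), r) W" and C: "fb_dia ((Q, C), r) Z"
      by (rule ev_box_dia[OF W(1) Z(1) evW evZ])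
    note m = member[OF D]
    obtain y where y: "y \<in> C" "(y, r) \<in> Z" using C by auto
    have "Q \<subseteq> {x \<in> X. (x, r) \<in> W}" using Q m by auto
    then have "y \<in> T closure_of ({x \<in> X. (x, r) \<in> W} \<inter> C)"
      using quasi_lensD(6)[OF m(1) openin_T_trace[OF W(1) m(2)]] y(1) by blast
    moreover have "y \<in> {x \<in> X. (x, r) \<in> Z}" "openin T {x \<in> X. (x, r) \<in> Z}"
      using y m openin_T_trace[OF Z(1) m(2)] by auto
    ultimately have "\<exists>z. z \<in> {x \<in> X. (x, r) \<in> W} \<inter> C \<and> z \<in> {x \<in> X. (x, r) \<in> Z}"
      unfolding in_closure_of by (elim conjE allE[of _ "{x \<in> X. (x, r) \<in> Z}"]) simp
    then obtain z where "z \<in> C" "(z, r) \<in> W \<inter> Z" by auto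
    then have "ev_dia (W \<inter> Z)" by (rule ev_diaI[OF D])
    then obtain z where "z \<in> lim_C" "(z, rad) \<in> W \<inter> Z"
      using ev_dia_iff[OF ball_open_Int[OF W(1) Z(1)]] by blast
    then show "\<exists>y. y \<in> U \<inter> lim_C \<and> y \<in> V"
      using W(2) Z(2) lim_C_subset by blast
  qed
qed

lemma lim_quasi_lens: "(lim_Q, lim_C) \<in> quasi_lenses X d"
proof -
  have "lim_Q \<inter> lim_C \<noteq> {}"
    using lim_Q_nonempty lim_Q_minimal by (auto simp: up_closure_def)
  then show ?thesis
    unfolding quasi_lenses_def
    using compact_lim_Q lim_Q_up closed_lim_C lim_Q_minimal lim_C_density by simp
qed

lemma lim_sup: "is_sup_on lens_balls lens_le D ((lim_Q, lim_C), rad)"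
proof (rule lens_sup_onI[OF D_sub])
  show "((lim_Q, lim_C), rad) \<in> lens_balls"
    using lim_quasi_lens rad_nonneg by simp
  show "fb_box ((lim_Q, lim_C), rad) U \<longleftrightarrow> (\<exists>\<gamma>\<in>D. fb_box \<gamma> U)" if "ball_open U" for U
    using ev_box_iff[OF that] by (simp add: ev_box_def)
  show "fb_dia ((lim_Q, lim_C), rad) U \<longleftrightarrow> (\<exists>\<gamma>\<in>D. fb_dia \<gamma> U)" if "ball_open U" for U
    using ev_dia_iff[OF that] by (simp add: ev_dia_def)
qed

text \<open>Uniqueness of suprema carries the equivalences from the constructed limit to any
  supremum of \<open>D\<close>; together with monotonicity, \<open>fb_box \<beta> U\<close> and
  \<open>fb_dia \<beta> U\<close> become Scott-open conditions on \<open>\<beta>\<close>.\<close>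

lemma lens_sup_box_dia:
  assumes "is_sup_on lens_balls lens_le D \<beta>" "ball_open U"
  shows "fb_box \<beta> U \<longleftrightarrow> (\<exists>\<gamma>\<in>D. fb_box \<gamma> U)" "fb_dia \<beta> U \<longleftrightarrow> (\<exists>\<gamma>\<in>D. fb_dia \<gamma> U)"
proof -
  have "\<beta> = ((lim_Q, lim_C), rad)"
    by (rule is_sup_on_unique[OF quasi_metric_lenses assms(1) lim_sup])
  then show "fb_box \<beta> U \<longleftrightarrow> (\<exists>\<gamma>\<in>D. fb_box \<gamma> U)" "fb_dia \<beta> U \<longleftrightarrow> (\<exists>\<gamma>\<in>D. fb_dia \<gamma> U)"
    using ev_box_iff[OF assms(2)] ev_dia_iff[OF assms(2)] by (simp_all add: ev_box_def ev_dia_def)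
qed

end

section \<open>Yoneda-completeness of the space of quasi-lenses\<close>

context algebraic_space
begin

lemma yoneda_complete_lenses: "yoneda_complete (quasi_lenses X d) (d_P X d)"
  unfolding yoneda_complete_def dcpo_on_def
proof (intro conjI allI impI)
  note qm = quasi_metric_lenses
  show "reflp_on lens_balls lens_le"
    using ball_le_refl[OF qm] by (simp add: reflp_on_def)
  show "transp_on lens_balls lens_le"
    using ball_le_trans[OF qm] unfolding transp_on_def by blast
  show "antisymp_on lens_balls lens_le"
    using ball_le_antisym[OF qm] unfolding antisymp_on_def by blast
  fix D assume "D \<subseteq> lens_balls \<and> directed_on lens_le D"
  then interpret lens_family X d B D by unfold_locales auto
  show "\<exists>\<beta>. is_sup_on lens_balls lens_le D \<beta>" using lim_sup by blast
qed

end

section \<open>Finitary lenses\<close>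

context yoneda_space
begin

lemma openin_T_up:
  assumes "openin T U" "x \<in> U" "y \<in> X" "d x y = 0"
  shows "y \<in> U"
proof -
  obtain W where W: "ball_open W" "U = {x \<in> X. (x, 0) \<in> W}"
    using assms(1) openin_T_iff[of 0] by auto
  then have "(x, 0) \<in> W" using assms(2) by simp
  then have "(y, 0) \<in> W" by (rule ball_openD[OF W(1)]) (use assms in simp_all)
  then show ?thesis using W(2) assms(3) by simp
qed

lemma subset_up_closure: "E \<subseteq> X \<Longrightarrow> E \<subseteq> up_closure X d E"
  and subset_down_closure: "E \<subseteq> X \<Longrightarrow> E \<subseteq> down_closure X d E"
  using quasi_metricD(1)[OF quasi_metric] by (auto simp: up_closure_def down_closure_def)

lemma compact_up_closure:
  assumes "finite E" "E \<subseteq> X"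
  shows "compactin T (up_closure X d E)"
  unfolding compactin_def
proof (intro conjI allI impI)
  show "up_closure X d E \<subseteq> topspace T" by (auto simp: up_closure_def)
  fix \<U> assume \<U>: "(\<forall>U\<in>\<U>. openin T U) \<and> up_closure X d E \<subseteq> \<Union>\<U>"
  have "\<forall>e\<in>E. \<exists>U\<in>\<U>. e \<in> U" using \<U> subset_up_closure[OF assms(2)] by blast
  then obtain f where f: "\<And>e. e \<in> E \<Longrightarrow> f e \<in> \<U> \<and> e \<in> f e" by metis
  have "up_closure X d E \<subseteq> \<Union>(f ` E)"
  proof
    fix y assume "y \<in> up_closure X d E"
    then obtain e where e: "e \<in> E" "y \<in> X" "d e y = 0" by (auto simp: up_closure_def)
    then have "y \<in> f e" using \<U> f by (intro openin_T_up[of "f e" e y]) auto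
    then show "y \<in> \<Union>(f ` E)" using e by blast
  qed
  then show "\<exists>\<F>. finite \<F> \<and> \<F> \<subseteq> \<U> \<and> up_closure X d E \<subseteq> \<Union>\<F>"
    using assms(1) f by (intro exI[of _ "f ` E"]) auto
qed

lemma closed_down_closure:
  assumes "finite E" "E \<subseteq> X"
  shows "closedin T (down_closure X d E)"
proof -
  have "closedin T {x \<in> X. d x e = 0}" if "e \<in> E" for e
  proof -
    have e: "(e, 0) \<in> formal_balls X" using that assms by auto
    have "X - {x \<in> X. d x e = 0} = {x \<in> X. (x, 0) \<in> {q \<in> formal_balls X. \<not> ball_le d q (e, 0)}}"
      by auto
    then have "openin T (X - {x \<in> X. d x e = 0})"
      using openin_T_trace[OF ball_open_not_below[OF e], of 0] by (simp only: order_refl)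
    then show ?thesis by (auto simp: closedin_def)
  qed
  then have "closedin T (\<Union>e\<in>E. {x \<in> X. d x e = 0})"
    using assms(1) by (intro closedin_Union) auto
  moreover have "(\<Union>e\<in>E. {x \<in> X. d x e = 0}) = down_closure X d E"
    by (auto simp: down_closure_def)
  ultimately show ?thesis by simp
qed

lemma up_closure_idem:
  assumes "E \<subseteq> X"
  shows "up_closure X d (up_closure X d E) = up_closure X d E"
proof
  show "up_closure X d E \<subseteq> up_closure X d (up_closure X d E)"
    by (rule subset_up_closure) (auto simp: up_closure_def)
  show "up_closure X d (up_closure X d E) \<subseteq> up_closure X d E"
  proof
    fix z assume "z \<in> up_closure X d (up_closure X d E)"
    then obtain y e where "z \<in> X" "y \<in> X" "e \<in> E" "d e y = 0" "d y z = 0"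
      by (auto simp: up_closure_def)
    moreover from this have "d e z \<le> d e y + d y z"
      using assms by (intro quasi_metricD(2)[OF quasi_metric]) auto
    ultimately show "z \<in> up_closure X d E" by (auto simp: up_closure_def)
  qed
qed

text \<open>Density holds because an open set containing a point below \<open>e \<in> E\<close> also
  contains \<open>e\<close>, and \<open>e\<close> belongs both to the down-closure and to every
  neighbourhood of the up-closure.\<close>

lemma finitary_lens_quasi_lens:
  assumes E: "finite E" "E \<noteq> {}" "E \<subseteq> X"
  shows "finitary_lens X d E \<in> quasi_lenses X d"
proof -
  let ?Q = "up_closure X d E" and ?C = "down_closure X d E"
  have sub: "E \<subseteq> ?Q \<inter> ?C"
    using subset_up_closure[OF E(3)] subset_down_closure[OF E(3)] by simp
  have "?C \<subseteq> T closure_of (U \<inter> ?C)" if U: "openin T U" "?Q \<subseteq> U" for U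
  proof
    fix x assume "x \<in> ?C"
    then obtain e where e: "x \<in> X" "e \<in> E" "d x e = 0" by (auto simp: down_closure_def)
    have "e \<in> U \<inter> ?C" "e \<in> X" using e sub U E by auto
    moreover have "e \<in> V" if "x \<in> V" "openin T V" for V
      using openin_T_up[OF that(2,1) \<open>e \<in> X\<close> e(3)] .
    ultimately show "x \<in> T closure_of (U \<inter> ?C)"
      unfolding in_closure_of using e(1) by auto
  qed
  moreover have "?Q \<subseteq> up_closure X d (?Q \<inter> ?C)"
    using sub by (auto simp: up_closure_def)
  moreover have "?Q \<inter> ?C \<noteq> {}" using sub E(2) by auto
  ultimately show ?thesis
    unfolding finitary_lens_def quasi_lenses_def
    using compact_up_closure closed_down_closure up_closure_idem E by simp
qed

text \<open>The balls \<open>\<beta>\<close> satisfying \<open>fin_below E \<epsilon> \<beta>\<close> form the analogue of \<^const>\<open>way_above\<close> for the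
  formal ball of radius \<open>\<epsilon>\<close> around the finitary lens of \<open>E\<close>.\<close>

definition fin_below :: "'a set \<Rightarrow> real \<Rightarrow> ('a set \<times> 'a set) \<times> real \<Rightarrow> bool" where
  "fin_below E \<epsilon> \<beta> \<longleftrightarrow> fb_box \<beta> (\<Union>e\<in>E. way_above (e, \<epsilon>)) \<and> (\<forall>e\<in>E. fb_dia \<beta> (way_above (e, \<epsilon>)))"

lemma fin_below_lens_le:
  assumes E: "finite E" "E \<noteq> {}" "E \<subseteq> X" and \<beta>: "\<beta> \<in> lens_balls" "fin_below E \<epsilon> \<beta>"
  shows "lens_le (finitary_lens X d E, \<epsilon>) \<beta>"
proof -
  obtain Q C s where eq: "\<beta> = ((Q, C), s)" by (metis surj_pair)
  then have L: "(Q, C) \<in> quasi_lenses X d" "0 \<le> s" using \<beta>(1) by simp_all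
  obtain e where "e \<in> E" using E(2) by auto
  then obtain y where "(y, s) \<in> way_above (e, \<epsilon>)" using \<beta>(2) eq by (auto simp: fin_below_def)
  then have "0 \<le> \<epsilon>" using way_above_radius L(2) by fastforce
  moreover note finitary_lens_quasi_lens[OF E]
  moreover have "fb_box \<beta> U" if U: "ball_open U" "fb_box (finitary_lens X d E, \<epsilon>) U" for U
  proof -
    have "(e, \<epsilon>) \<in> U" if "e \<in> E" for e
      using U(2) that subset_up_closure[OF E(3)] by (auto simp: finitary_lens_def)
    then have "(\<Union>e\<in>E. way_above (e, \<epsilon>)) \<subseteq> U" using way_above_subset[OF U(1)] by blast
    then show ?thesis using \<beta>(2) fb_box_mono unfolding fin_below_def by blast
  qed
  moreover have "fb_dia \<beta> U" if U: "ball_open U" "fb_dia (finitary_lens X d E, \<epsilon>) U" for U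
  proof -
    obtain y where y: "y \<in> down_closure X d E" "(y, \<epsilon>) \<in> U"
      using U(2) by (auto simp: finitary_lens_def)
    then obtain e where e: "e \<in> E" "d y e = 0" by (auto simp: down_closure_def)
    have "(e, \<epsilon>) \<in> U"
      by (rule ball_openD[OF U(1) y(2)]) (use e E \<open>0 \<le> \<epsilon>\<close> in auto)
    then show ?thesis
      using \<beta>(2) e(1) way_above_subset[OF U(1)] fb_dia_mono unfolding fin_below_def by blast
  qed
  ultimately show ?thesis using \<beta>(1) by (subst lens_le_iff) auto
qed

lemma fin_below_mono:
  assumes E: "\<And>e. e \<in> E \<Longrightarrow> center_point X d e"
    and \<beta>: "\<beta> \<in> lens_balls" "\<gamma> \<in> lens_balls" "lens_le \<beta> \<gamma>" "fin_below E \<epsilon> \<beta>"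
  shows "fin_below E \<epsilon> \<gamma>"
proof -
  have "ball_open (\<Union>e\<in>E. way_above (e, \<epsilon>))"
    using E by (intro ball_open_Union) (auto intro: ball_open_way_above)
  then show ?thesis
    using lens_le_iff[OF \<beta>(1,2)] \<beta>(3,4) ball_open_way_above[OF E] unfolding fin_below_def by blast
qed

text \<open>Passing \<open>fin_below\<close> at \<open>\<epsilon>'\<close> bounds the distance by
  \<open>\<epsilon>' - s\<close> only non-strictly, hence the smaller \<open>\<epsilon>'\<close>.
  Conversely, if the distance is \<open>c\<close>, the ball of radius \<open>s + c\<close> around
  the finitary lens passes the test at any \<open>\<epsilon>' > s + c\<close>, here the midpoint of
  \<open>s + c\<close> and \<open>\<epsilon>\<close>, and \<open>(L, s)\<close> lies above that
  ball.\<close>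

lemma d_P_finitary_less_iff:
  assumes E: "finite E" "E \<noteq> {}" "\<And>e. e \<in> E \<Longrightarrow> center_point X d e" and \<beta>: "(L, s) \<in> lens_balls"
  shows "d_P X d (finitary_lens X d E) L < ennreal (\<epsilon> - s) \<longleftrightarrow> (\<exists>\<epsilon>'<\<epsilon>. fin_below E \<epsilon>' (L, s))"
proof -
  have EX: "E \<subseteq> X" using E(3) by (auto simp: center_point_def)
  note FL = finitary_lens_quasi_lens[OF E(1,2) EX]
  show ?thesis
  proof
    assume lt: "d_P X d (finitary_lens X d E) L < ennreal (\<epsilon> - s)"
    then obtain c where c: "d_P X d (finitary_lens X d E) L = ennreal c" "0 \<le> c"
      by (cases "d_P X d (finitary_lens X d E) L") auto
    then have "s + c < \<epsilon>" using lt by (simp add: ennreal_less_iff)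
    define \<epsilon>' where "\<epsilon>' = (s + c + \<epsilon>) / 2"
    have \<epsilon>': "s + c < \<epsilon>'" "\<epsilon>' < \<epsilon>" using \<open>s + c < \<epsilon>\<close> by (auto simp: \<epsilon>'_def)
    let ?\<alpha> = "(finitary_lens X d E, s + c)"
    have "0 \<le> s" using \<beta> by simp
    have mem: "(y, s + c) \<in> way_above (e, \<epsilon>')" if "e \<in> E" "y \<in> X" "d e y = 0" for e y
      using that \<open>0 \<le> s\<close> c(2) \<epsilon>' by simp
    have "fin_below E \<epsilon>' ?\<alpha>"
      unfolding fin_below_def
    proof
      show "fb_box ?\<alpha> (\<Union>e\<in>E. way_above (e, \<epsilon>'))"
        using mem unfolding finitary_lens_def fb_box_iff up_closure_def by blast
      show "\<forall>e\<in>E. fb_dia ?\<alpha> (way_above (e, \<epsilon>'))"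
        using mem EX subset_down_closure[OF EX] quasi_metricD(1)[OF quasi_metric]
        unfolding finitary_lens_def fb_dia_iff by blast
    qed
    moreover have "lens_le ?\<alpha> (L, s)" using c by simp
    moreover have "?\<alpha> \<in> lens_balls" using FL \<open>0 \<le> s\<close> c(2) by simp
    ultimately have "fin_below E \<epsilon>' (L, s)" using fin_below_mono[OF E(3)] \<beta> by blast
    then show "\<exists>\<epsilon>'<\<epsilon>. fin_below E \<epsilon>' (L, s)" using \<epsilon>'(2) by blast
  next
    assume "\<exists>\<epsilon>'<\<epsilon>. fin_below E \<epsilon>' (L, s)"
    then obtain \<epsilon>' where \<epsilon>': "\<epsilon>' < \<epsilon>" "fin_below E \<epsilon>' (L, s)" by blast
    then have "s \<le> \<epsilon>'" "d_P X d (finitary_lens X d E) L \<le> ennreal (\<epsilon>' - s)"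
      using fin_below_lens_le[OF E(1,2) EX \<beta>] by simp_all
    moreover have "ennreal (\<epsilon>' - s) < ennreal (\<epsilon> - s)"
      using \<epsilon>'(1) \<open>s \<le> \<epsilon>'\<close> by (intro ennreal_lessI) auto
    ultimately show "d_P X d (finitary_lens X d E) L < ennreal (\<epsilon> - s)"
      by (metis le_less_trans)
  qed
qed

lemma ball_open_shrink:
  assumes "ball_open U" "(x, s) \<in> U" "0 \<le> t" "t \<le> s"
  shows "(x, t) \<in> U"
proof -
  have "x \<in> X" using subsetD[OF scott_open_onD(1)[OF assms(1)] assms(2)] by simp
  then show ?thesis
    using assms quasi_metricD(1)[OF quasi_metric] by (intro ball_openD[OF assms(1,2)]) simp_all
qed

end

section \<open>Finitary lenses of center points are center points\<close>

context algebraic_space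
begin

lemma finitary_lens_center_point:
  assumes E: "finite E" "E \<noteq> {}" "\<And>e. e \<in> E \<Longrightarrow> center_point X d e"
  shows "center_point (quasi_lenses X d) (d_P X d) (finitary_lens X d E)"
  unfolding center_point_def
proof (intro conjI allI impI)
  have EX: "E \<subseteq> X" using E(3) by (auto simp: center_point_def)
  show "finitary_lens X d E \<in> quasi_lenses X d" by (rule finitary_lens_quasi_lens[OF E(1,2) EX])
  fix \<epsilon> :: real
  have eq: "{(L, s). (L, s) \<in> lens_balls \<and> d_P X d (finitary_lens X d E) L < ennreal (\<epsilon> - s)}
    = {\<beta> \<in> lens_balls. \<exists>\<epsilon>'<\<epsilon>. fin_below E \<epsilon>' \<beta>}"
    using d_P_finitary_less_iff[OF E] by auto
  have "scott_open_on lens_balls lens_le {\<beta> \<in> lens_balls. \<exists>\<epsilon>'<\<epsilon>. fin_below E \<epsilon>' \<beta>}"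
  proof (rule scott_open_onI, goal_cases)
    case (2 \<beta> \<gamma>)
    then show ?case using fin_below_mono[OF E(3)] by blast
  next
    case (3 D \<beta>)
    then interpret lens_family X d B D by unfold_locales auto
    obtain \<epsilon>' where \<epsilon>': "\<epsilon>' < \<epsilon>" "fin_below E \<epsilon>' \<beta>" using 3 by blast
    let ?U = "\<Union>e\<in>E. way_above (e, \<epsilon>')"
    have oU: "ball_open ?U"
      using E(3) by (intro ball_open_Union) (auto intro: ball_open_way_above)
    have o: "ball_open (way_above (e, \<epsilon>'))" if "e \<in> E" for e
      using E(3)[OF that] by (rule ball_open_way_above)
    obtain \<gamma>0 where \<gamma>0: "\<gamma>0 \<in> D" "fb_box \<gamma>0 ?U"
      using \<epsilon>'(2) lens_sup_box_dia(1)[OF 3(3) oU] unfolding fin_below_def by blast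
    have "\<forall>e\<in>E. \<exists>\<gamma>\<in>D. fb_dia \<gamma> (way_above (e, \<epsilon>'))"
      using \<epsilon>'(2) lens_sup_box_dia(2)[OF 3(3) o] unfolding fin_below_def by blast
    then obtain g where g: "\<And>e. e \<in> E \<Longrightarrow> g e \<in> D \<and> fb_dia (g e) (way_above (e, \<epsilon>'))" by metis
    \<comment> \<open>Each of the finitely many tests has its own member of \<open>D\<close>; an
      upper bound of these in \<open>D\<close> passes them all.\<close>
    have "\<exists>\<gamma>\<in>D. \<forall>\<alpha>\<in>insert \<gamma>0 (g ` E). lens_le \<alpha> \<gamma>"
    proof (rule directed_on_finite_ub[OF 3(2,1)])
      show "finite (insert \<gamma>0 (g ` E))" using E(1) by simp
      show "insert \<gamma>0 (g ` E) \<subseteq> D" using g \<gamma>0 by blast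
    qed (rule ball_le_trans[OF quasi_metric_lenses])
    then obtain \<gamma> where \<gamma>: "\<gamma> \<in> D" "lens_le \<gamma>0 \<gamma>" "\<And>e. e \<in> E \<Longrightarrow> lens_le (g e) \<gamma>" by auto
    have "fb_box \<gamma> ?U" by (rule box_mono[OF \<gamma>0(1) \<gamma>(1,2) oU \<gamma>0(2)])
    moreover have "fb_dia \<gamma> (way_above (e, \<epsilon>'))" if "e \<in> E" for e
      using g[OF that] dia_mono[OF _ \<gamma>(1) \<gamma>(3)[OF that] o[OF that]] by blast
    ultimately have "fin_below E \<epsilon>' \<gamma>" by (simp add: fin_below_def)
    then show ?case using \<gamma>(1) \<epsilon>'(1) 3(1) by blast
  qed auto
  then show "openin (ball_topology (quasi_lenses X d) (d_P X d))
    {(L, s). (L, s) \<in> lens_balls \<and> d_P X d (finitary_lens X d E) L < ennreal (\<epsilon> - s)}"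
    unfolding eq openin_scott_topology .
qed

section \<open>Approximation of quasi-lenses by finitary ones\<close>

lemma approx_by_center_same_radius:
  assumes U: "ball_open U" "(y, \<eta>) \<in> U" and "0 < \<delta>"
  obtains b where "b \<in> B" "d b y < ennreal \<delta>" "(b, \<eta>) \<in> U"
proof -
  obtain b t where b: "b \<in> B" "0 < t" "t < \<delta>" "d b y < ennreal t" "(b, \<eta> + t) \<in> U"
    by (rule approx_by_center[OF U \<open>0 < \<delta>\<close>])
  have "0 \<le> \<eta>" using subsetD[OF scott_open_onD(1)[OF U(1)] U(2)] by simp
  then have "(b, \<eta>) \<in> U" using b by (intro ball_open_shrink[OF U(1) b(5)]) auto
  moreover have "d b y < ennreal \<delta>"
    using b(4) by (rule less_le_trans) (use b(3) in \<open>simp add: ennreal_leI\<close>)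
  ultimately show ?thesis using that b(1) by blast
qed

text \<open>Besides passing the tests, every element of \<open>E\<close> must be near a point of
  \<open>C\<close>, or the distance to \<open>(Q, C)\<close> would not be small. The two lens
  conditions supply this: points of \<open>Q \<inter> C\<close> suffice to cover \<open>Q\<close>,
  and density gives points of \<open>C\<close> over \<open>U \<inter> V\<close>.\<close>

lemma finitary_lens_approx:
  assumes L: "(Q, C) \<in> quasi_lenses X d" and U: "ball_open U" "fb_box ((Q, C), 0) U"
    and V: "finite \<V>" "\<And>V. V \<in> \<V> \<Longrightarrow> ball_open V" "\<And>V. V \<in> \<V> \<Longrightarrow> fb_dia ((Q, C), 0) V"
  obtains E r where "finite E" "E \<noteq> {}" "E \<subseteq> B" "0 < r" "d_P X d (finitary_lens X d E) (Q, C) < ennreal r"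
    "fb_box (finitary_lens X d E, r) U" "\<And>V. V \<in> \<V> \<Longrightarrow> fb_dia (finitary_lens X d E, r) V"
proof -
  note lens = quasi_lensD[OF L]
  have "\<exists>\<eta>>0. \<forall>x\<in>Q. (x, 0 + \<eta>) \<in> U"
    by (rule compact_room[OF lens(1) U(1) order_refl]) (use U(2) in auto)
  then obtain \<eta>0 where \<eta>0: "0 < \<eta>0" "\<And>x. x \<in> Q \<Longrightarrow> (x, \<eta>0) \<in> U" by auto
  have "\<exists>x \<eta>. x \<in> C \<and> 0 < \<eta> \<and> (x, \<eta>) \<in> V" if VV: "V \<in> \<V>" for V
  proof -
    obtain x where x: "x \<in> C" "(x, 0) \<in> V" using V(3)[OF VV] by auto
    obtain \<eta> where "0 < \<eta>" "(x, 0 + \<eta>) \<in> V" by (rule ball_open_room[OF V(2)[OF VV] x(2)])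
    then show ?thesis using x(1) by auto
  qed
  then obtain p \<eta>' where p: "\<And>V. V \<in> \<V> \<Longrightarrow> p V \<in> C \<and> 0 < \<eta>' V \<and> (p V, \<eta>' V) \<in> V"
    by metis
  \<comment> \<open>A common slack for all tests. Centers will be within \<open>\<eta> / 2\<close>
    of their points, which leaves the distance to \<open>(Q, C)\<close> strictly below the radius
    \<open>\<eta>\<close>.\<close>
  define \<eta> where "\<eta> = Min (insert \<eta>0 (\<eta>' ` \<V>))"
  have \<eta>: "0 < \<eta>" "\<eta> \<le> \<eta>0" and \<eta>V: "\<And>V. V \<in> \<V> \<Longrightarrow> \<eta> \<le> \<eta>' V"
    using \<eta>0(1) p V(1) by (auto simp: \<eta>_def)
  have \<eta>2: "0 < \<eta> / 2" "\<eta> / 2 < \<eta>" using \<eta>(1) by simp_all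
  have QU: "(x, \<eta>) \<in> U" if "x \<in> Q" for x
    by (rule ball_open_shrink[OF U(1) \<eta>0(2)[OF that]]) (use \<eta> in simp_all)
  have pV: "(p V, \<eta>) \<in> V" if "V \<in> \<V>" for V
  proof (rule ball_open_shrink[OF V(2)[OF that]])
    show "(p V, \<eta>' V) \<in> V" using p[OF that] by simp
  qed (use \<eta> \<eta>V[OF that] in simp_all)
  let ?U = "{x \<in> X. (x, \<eta>) \<in> U}"
  have "openin T ?U" using \<eta> by (intro openin_T_trace U(1)) simp
  moreover have "Q \<subseteq> ?U" using QU lens(7) by auto
  ultimately have dense: "C \<subseteq> T closure_of (?U \<inter> C)" by (rule lens(6))
  \<comment> \<open>\<open>p V\<close> need not lie over \<open>U\<close>, and a center near it
    could spoil the box test; density of \<open>?U \<inter> C\<close> replaces it by a point over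
    both \<open>U\<close> and \<open>V\<close>.\<close>
  have "\<exists>y\<in>C. (y, \<eta>) \<in> U \<inter> V" if VV: "V \<in> \<V>" for V
  proof -
    have "p V \<in> T closure_of (?U \<inter> C)" using p[OF VV] dense by blast
    moreover have "openin T {x \<in> X. (x, \<eta>) \<in> V}" "p V \<in> {x \<in> X. (x, \<eta>) \<in> V}"
      using openin_T_trace[OF V(2)[OF VV], of \<eta>] \<eta> pV[OF VV] p[OF VV] lens(8) by auto
    ultimately have "\<exists>y. y \<in> ?U \<inter> C \<and> y \<in> {x \<in> X. (x, \<eta>) \<in> V}"
      unfolding in_closure_of by (elim conjE allE[of _ "{x \<in> X. (x, \<eta>) \<in> V}"]) simp
    then show ?thesis by auto
  qed
  then obtain q where q: "\<And>V. V \<in> \<V> \<Longrightarrow> q V \<in> C \<and> (q V, \<eta>) \<in> U \<inter> V" by metis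
  have "\<exists>b\<in>B. d b (q V) < ennreal (\<eta> / 2) \<and> (b, \<eta>) \<in> U \<inter> V" if VV: "V \<in> \<V>" for V
  proof -
    have "(q V, \<eta>) \<in> U \<inter> V" using q[OF VV] by simp
    from approx_by_center_same_radius[OF ball_open_Int[OF U(1) V(2)[OF VV]] this \<eta>2(1)]
    show ?thesis by blast
  qed
  then obtain g where g: "\<And>V. V \<in> \<V> \<Longrightarrow> g V \<in> B \<and> d (g V) (q V) < ennreal (\<eta> / 2) \<and> (g V, \<eta>) \<in> U \<inter> V"
    by metis
  have "\<exists>b\<in>B. d b y < ennreal (\<eta> / 2) \<and> (b, \<eta>) \<in> U" if "y \<in> Q \<inter> C" for y
    using approx_by_center_same_radius[OF U(1) QU \<eta>2(1)] that by blast
  then obtain f where f: "\<And>y. y \<in> Q \<inter> C \<Longrightarrow> f y \<in> B \<and> d (f y) y < ennreal (\<eta> / 2) \<and> (f y, \<eta>) \<in> U"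
    by metis
  \<comment> \<open>A point of \<open>Q\<close> above \<open>y\<close> inherits the bound on the
    distance from the center \<open>f y\<close>, so indexing the cover by
    \<open>Q \<inter> C\<close> is enough.\<close>
  have cov: "\<exists>y\<in>Q \<inter> C. (x, 0) \<in> way_above (f y, \<eta> / 2)" if x: "x \<in> Q" for x
  proof -
    obtain y where y: "y \<in> Q \<inter> C" "d y x = 0" using lens(5) x by (auto simp: up_closure_def)
    have "d (f y) x \<le> d (f y) y + d y x"
      using f[OF y(1)] y(1) x lens(7) B_subset by (intro quasi_metricD(2)[OF quasi_metric]) auto
    then have "d (f y) x < ennreal (\<eta> / 2)" using f[OF y(1)] y(2) by (auto intro: le_less_trans)
    then show ?thesis using y(1) x lens(7) by (intro bexI[of _ y]) auto
  qed
  have oc: "ball_open (way_above (f y, \<eta> / 2))" if "y \<in> Q \<inter> C" for y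
    using f[OF that] center by (intro ball_open_way_above) blast
  have "\<exists>J. finite J \<and> J \<subseteq> Q \<inter> C \<and> (\<forall>x\<in>Q. \<exists>y\<in>J. (x, 0) \<in> way_above (f y, \<eta> / 2))"
  proof (rule compact_cover[of Q 0 "Q \<inter> C" "\<lambda>y. way_above (f y, \<eta> / 2)", OF lens(1) order_refl oc cov])
    fix J assume "finite J" "J \<subseteq> Q \<inter> C" "\<And>x. x \<in> Q \<Longrightarrow> \<exists>y\<in>J. (x, 0) \<in> way_above (f y, \<eta> / 2)"
    then show ?thesis by (intro exI[of _ J] conjI ballI)
  qed
  then obtain J where J: "finite J" "J \<subseteq> Q \<inter> C" "\<forall>x\<in>Q. \<exists>y\<in>J. (x, 0) \<in> way_above (f y, \<eta> / 2)"
    by (elim exE conjE)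
  define E where "E = f ` J \<union> g ` \<V>"
  have E: "finite E" "E \<subseteq> B" using J(1,2) V(1) f g by (auto simp: E_def)
  have EX: "E \<subseteq> X" using E(2) B_subset by blast
  have EU: "(e, \<eta>) \<in> U" if "e \<in> E" for e using that J(2) f g by (auto simp: E_def)
  obtain x where "x \<in> Q" using lens(4) by auto
  then have "E \<noteq> {}" using J(3) by (fastforce simp: E_def)
  have "fin_below E (\<eta> / 2) ((Q, C), 0)"
    unfolding fin_below_def
  proof (intro conjI ballI)
    show "fb_box ((Q, C), 0) (\<Union>e\<in>E. way_above (e, \<eta> / 2))"
      unfolding fb_box_iff
    proof
      fix x assume "x \<in> Q"
      then obtain y where "y \<in> J" "(x, 0) \<in> way_above (f y, \<eta> / 2)" using J(3) by blast
      moreover from this have "f y \<in> E" by (simp add: E_def)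
      ultimately show "(x, 0) \<in> (\<Union>e\<in>E. way_above (e, \<eta> / 2))" by (intro UN_I)
    qed
    fix e assume "e \<in> E"
    then consider y where "y \<in> J" "e = f y" | V where "V \<in> \<V>" "e = g V"
      unfolding E_def by blast
    then have "\<exists>y\<in>C. d e y < ennreal (\<eta> / 2)"
    proof cases
      case 1
      then show ?thesis using J(2) f[of y] by (intro bexI[of _ y]) auto
    next
      case 2
      then show ?thesis using g[of V] q[of V] by (intro bexI[of _ "q V"]) auto
    qed
    then show "fb_dia ((Q, C), 0) (way_above (e, \<eta> / 2))" using lens(8) by auto
  qed
  then have "\<exists>\<epsilon><\<eta>. fin_below E \<epsilon> ((Q, C), 0)" using \<eta>2(2) by blast
  moreover have "center_point X d e" if "e \<in> E" for e using that E(2) center by blast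
  ultimately have "d_P X d (finitary_lens X d E) (Q, C) < ennreal (\<eta> - 0)"
    using d_P_finitary_less_iff[of E "(Q, C)" 0 \<eta>] E(1) \<open>E \<noteq> {}\<close> L by simp
  moreover have "fb_box (finitary_lens X d E, \<eta>) U"
  proof -
    have "(y, \<eta>) \<in> U" if "y \<in> X" "e \<in> E" "d e y = 0" for y e
      by (rule ball_openD[OF U(1) EU[OF that(2)]]) (use that \<eta> in simp_all)
    then show ?thesis by (auto simp: finitary_lens_def up_closure_def)
  qed
  moreover have "fb_dia (finitary_lens X d E, \<eta>) V" if "V \<in> \<V>" for V
  proof -
    have "g V \<in> down_closure X d E" using subset_down_closure[OF EX] that by (auto simp: E_def)
    then show ?thesis using g[OF that] by (auto simp: finitary_lens_def)
  qed
  ultimately show ?thesis using that[of E \<eta>] E \<open>E \<noteq> {}\<close> \<eta>(1) by simp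
qed

lemma finitary_lenses_strong_basis:
  "strong_basis (quasi_lenses X d) (d_P X d) {finitary_lens X d E | E. finite E \<and> E \<noteq> {} \<and> E \<subseteq> B}"
  unfolding strong_basis_def
proof (intro conjI ballI)
  fix b assume "b \<in> {finitary_lens X d E | E. finite E \<and> E \<noteq> {} \<and> E \<subseteq> B}"
  then show "center_point (quasi_lenses X d) (d_P X d) b"
    using finitary_lens_center_point center by blast
next
  fix L assume L: "L \<in> quasi_lenses X d"
  then obtain Q C where eq: "L = (Q, C)" by fastforce
  let ?ok = "\<lambda>E r. finite E \<and> E \<noteq> {} \<and> E \<subseteq> B \<and> 0 \<le> r \<and> d_P X d (finitary_lens X d E) L < ennreal r"
  \<comment> \<open>Strictness of the distance bound makes \<open>D\<close> directed: by
    \<open>d_P_finitary_less_iff\<close> it yields open tests passed by \<open>(L, 0)\<close>, and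
    the tests of two members can be imposed together.\<close>
  define D where "D = {(finitary_lens X d E, r) | E r. ?ok E r}"
  have L0: "(L, 0) \<in> lens_balls" using L by simp
  have FL: "(finitary_lens X d E, r) \<in> lens_balls" if "?ok E r" for E r
    using that finitary_lens_quasi_lens[of E] B_subset by auto
  have D_lens: "D \<subseteq> lens_balls" unfolding D_def using FL by blast
  \<comment> \<open>Box tests merge by intersection of the open sets, diamond tests do not; hence
    one box but a finite set of diamonds.\<close>
  have approx: "\<exists>\<gamma>\<in>D. fb_box \<gamma> U \<and> (\<forall>V\<in>\<V>. fb_dia \<gamma> V)"
    if "ball_open U" "fb_box (L, 0) U" "finite \<V>" "\<And>V. V \<in> \<V> \<Longrightarrow> ball_open V"
      "\<And>V. V \<in> \<V> \<Longrightarrow> fb_dia (L, 0) V" for U \<V>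
  proof (rule finitary_lens_approx[of Q C U \<V>])
    fix E r assume "finite E" "E \<noteq> {}" "E \<subseteq> B" "0 < r" "d_P X d (finitary_lens X d E) (Q, C) < ennreal r"
      "fb_box (finitary_lens X d E, r) U" "\<And>V. V \<in> \<V> \<Longrightarrow> fb_dia (finitary_lens X d E, r) V"
    moreover from this have "(finitary_lens X d E, r) \<in> D" unfolding D_def eq by auto
    ultimately show ?thesis by blast
  qed (use that L eq in auto)
  have all: "fb_box (L, 0) (formal_balls X)"
    using quasi_lensD(7)[of Q C] L eq by auto
  have "directed_on lens_le D"
    unfolding directed_on_def
  proof (intro conjI ballI)
    show "D \<noteq> {}" using approx[of "formal_balls X" "{}"] ball_open_all all by auto
  next
    fix \<alpha> \<beta> assume "\<alpha> \<in> D" "\<beta> \<in> D"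
    then obtain E1 r1 E2 r2 where E: "\<alpha> = (finitary_lens X d E1, r1)" "?ok E1 r1"
      "\<beta> = (finitary_lens X d E2, r2)" "?ok E2 r2"
      unfolding D_def by blast
    have below: "\<exists>\<epsilon><r. fin_below E \<epsilon> (L, 0)" if "?ok E r" for E r
    proof -
      have "center_point X d e" if "e \<in> E" for e using that \<open>?ok E r\<close> center by blast
      then show ?thesis using d_P_finitary_less_iff[of E L 0 r] that L0 by simp
    qed
    obtain \<epsilon>1 \<epsilon>2 where \<epsilon>: "\<epsilon>1 < r1" "fin_below E1 \<epsilon>1 (L, 0)" "\<epsilon>2 < r2" "fin_below E2 \<epsilon>2 (L, 0)"
      using below[OF E(2)] below[OF E(4)] by (elim exE conjE)
    let ?W = "\<lambda>E \<epsilon>. \<Union>e\<in>E. way_above (e, \<epsilon>)"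
    let ?\<V> = "(\<lambda>e. way_above (e, \<epsilon>1)) ` E1 \<union> (\<lambda>e. way_above (e, \<epsilon>2)) ` E2"
    have o: "ball_open (way_above (e, \<epsilon>))" if "e \<in> E1 \<union> E2" for e \<epsilon>
      using that E center by (intro ball_open_way_above) blast
    have oW: "ball_open (?W E1 \<epsilon>1 \<inter> ?W E2 \<epsilon>2)"
      using o by (intro ball_open_Int ball_open_Union) auto
    have boxW: "fb_box (L, 0) (?W E1 \<epsilon>1 \<inter> ?W E2 \<epsilon>2)"
      using \<epsilon>(2,4) unfolding eq fin_below_def fb_box_iff by blast
    have "\<exists>\<gamma>\<in>D. fb_box \<gamma> (?W E1 \<epsilon>1 \<inter> ?W E2 \<epsilon>2) \<and> (\<forall>V\<in>?\<V>. fb_dia \<gamma> V)"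
    proof (rule approx[OF oW boxW])
      show "finite ?\<V>" using E by simp
      show "ball_open V" if "V \<in> ?\<V>" for V using that o by auto
      show "fb_dia (L, 0) V" if "V \<in> ?\<V>" for V
        using that \<epsilon>(2,4) unfolding fin_below_def by auto
    qed
    then obtain \<gamma> where \<gamma>: "\<gamma> \<in> D" "fb_box \<gamma> (?W E1 \<epsilon>1 \<inter> ?W E2 \<epsilon>2)" "\<forall>V\<in>?\<V>. fb_dia \<gamma> V"
      by (elim bexE conjE)
    have fin: "fin_below E1 \<epsilon>1 \<gamma>" "fin_below E2 \<epsilon>2 \<gamma>"
      unfolding fin_below_def using fb_box_mono[OF \<gamma>(2) Int_lower1] fb_box_mono[OF \<gamma>(2) Int_lower2] \<gamma>(3)
      by simp_all
    have "\<gamma> \<in> lens_balls" using \<gamma>(1) D_lens by blast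
    have weaken: "lens_le (finitary_lens X d E, r) \<gamma>" if "?ok E r" "\<epsilon> < r" "fin_below E \<epsilon> \<gamma>" for E r \<epsilon>
    proof -
      have "E \<subseteq> X" using that B_subset by blast
      then have "lens_le (finitary_lens X d E, \<epsilon>) \<gamma>"
        using that \<open>\<gamma> \<in> lens_balls\<close> by (intro fin_below_lens_le) auto
      then show ?thesis
        using that(2) by (cases \<gamma>) (auto intro: order_trans ennreal_leI)
    qed
    have "lens_le \<alpha> \<gamma>" "lens_le \<beta> \<gamma>"
      using weaken[OF E(2) \<epsilon>(1) fin(1)] weaken[OF E(4) \<epsilon>(3) fin(2)] E(1,3) by simp_all
    then show "\<exists>\<gamma>\<in>D. lens_le \<alpha> \<gamma> \<and> lens_le \<beta> \<gamma>" using \<gamma>(1) by blast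
  qed
  moreover have "is_sup_on lens_balls lens_le D (L, 0)"
  proof (rule lens_sup_onI[OF D_lens L0])
    fix U assume U: "ball_open U"
    have le: "lens_le \<gamma> (L, 0)" if "\<gamma> \<in> D" for \<gamma>
      using that unfolding D_def by (auto intro: less_imp_le)
    have imp: "fb_box \<gamma> U \<longrightarrow> fb_box (L, 0) U" "fb_dia \<gamma> U \<longrightarrow> fb_dia (L, 0) U" if "\<gamma> \<in> D" for \<gamma>
      using lens_le_iff[of \<gamma> "(L, 0)"] le[OF that] subsetD[OF D_lens that] L0 U by blast+
    show "fb_box (L, 0) U \<longleftrightarrow> (\<exists>\<gamma>\<in>D. fb_box \<gamma> U)"
      using approx[OF U, of "{}"] imp(1) by blast
    show "fb_dia (L, 0) U \<longleftrightarrow> (\<exists>\<gamma>\<in>D. fb_dia \<gamma> U)"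
      using approx[OF ball_open_all all, of "{U}"] imp(2) U by blast
  qed
  moreover have "D \<subseteq> formal_balls {finitary_lens X d E | E. finite E \<and> E \<noteq> {} \<and> E \<subseteq> B}"
    unfolding D_def by auto
  ultimately show "\<exists>D\<subseteq>formal_balls {finitary_lens X d E | E. finite E \<and> E \<noteq> {} \<and> E \<subseteq> B}.
      directed_on lens_le D \<and> is_sup_on lens_balls lens_le D (L, 0)"
    by blast
qed

end

theorem theorem15p11:
  fixes X :: "'a set" and d :: "'a \<Rightarrow> 'a \<Rightarrow> ennreal" and \<B> :: "'a set"
  assumes "quasi_metric X d"
    and "yoneda_complete X d"
    and "algebraic_qm X d"
    and "strong_basis X d \<B>"
  shows "quasi_metric (quasi_lenses X d) (d_P X d)
    \<and> yoneda_complete (quasi_lenses X d) (d_P X d)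
    \<and> algebraic_qm (quasi_lenses X d) (d_P X d)
    \<and> (\<forall>E. finite E \<and> E \<noteq> {} \<and> (\<forall>x\<in>E. center_point X d x) \<longrightarrow>
          center_point (quasi_lenses X d) (d_P X d) (finitary_lens X d E))
    \<and> strong_basis (quasi_lenses X d) (d_P X d)
          {finitary_lens X d E | E. finite E \<and> E \<noteq> {} \<and> E \<subseteq> \<B>}"
proof -
  interpret algebraic_space X d \<B>
    using assms by unfold_locales
  show ?thesis
    unfolding algebraic_qm_def
    using quasi_metric_lenses yoneda_complete_lenses finitary_lens_center_point
      finitary_lenses_strong_basis
    by blast
qed

end
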